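(* Let $n\ge1$, and let $B_1,\dots,B_n$ be finite Blaschke products on $\mathbb{D}$ with $r_1,\dots,r_n\ge1$ factors respectively. Let $\mathcal{M}$ be a Hilbert space which is a vector subspace of $H^p(\mathbb{D}^n)$ for some $p>2$ ($p\le\infty$). Suppose the operators $T_1,\dots,T_n$ of multiplication by $B_1(z_1),\dots,B_n(z_n)$ satisfy the following conditions on $\mathcal{M}$: (i) $T_j\mathcal{M}\subseteq\mathcal{M}$ for each $j$; (ii) each $T_j$ is a near-isometry on $\mathcal{M}$; (iii) the tuple $(T_1,\dots,T_n)$ doubly commutes on $\mathcal{M}$. Then $\mathcal{M}=\{0\}$.
   Context: $\mathbb{D}^n$ is the open unit polydisc in $\mathbb{C}^n$ and $H^p(\mathbb{D}^n)$ is the usual Hardy space of analytic functions on $\mathbb{D}^n$. $\mathcal{M}$ carries its own Hilbert space inner product, not assumed related to the norm of $H^p(\mathbb{D}^n)$. $B_i(z)=\prod_{l=1}^{r_i}\frac{z-\alpha_l^i}{1-\overline{\alpha_l^i}z}$ with $\alpha_l^i\in\mathbb{D}$. $T_i$ denotes the operator $(T_if)(z_1,\dots,z_n)=B_i(z_i)f(z_1,\dots,z_n)$. An operator $T\in B(\mathcal{H})$ on a Hilbert space $\mathcal{H}$ is a near-isometry if (i) there is $\delta>0$ such that $\delta\|x\|\le\|Tx\|\le\|x\|$ for all $x\in\mathcal{H}$, and (ii) for each $k\ge1$, $T^{*k}T^{k+1}\mathcal{H}\subseteq T\mathcal{H}$. A tuple of commuting operators $(T_1,\dots,T_n)$ is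 doubly commuting if $T_iT_j^*=T_j^*T_i$ whenever $i\neq j$. Here all adjoints are with respect to the inner product of $\mathcal{M}$. *)

theory Defs
  imports "HOL-Analysis.Analysis" "HOL-Library.Function_Algebras"
begin

section \<open>Complex Hilbert spaces on a carrier, and operators on them\<close>

text \<open>
  The inner product \<open>ip\<close> is linear in the first and conjugate-linear in the second argument.
  Only the values of \<open>ip\<close> and of operators on the carrier \<open>H\<close> matter.
\<close>

definition ip_norm :: "('a \<Rightarrow> 'a \<Rightarrow> complex) \<Rightarrow> 'a \<Rightarrow> real" where
  "ip_norm ip x = sqrt (Re (ip x x))"

locale complex_hilbert_space = vector_space smul
  for smul :: "complex \<Rightarrow> 'a::ab_group_add \<Rightarrow> 'a" +
  fixes H :: "'a set" and ip :: "'a \<Rightarrow> 'a \<Rightarrow> complex"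
  assumes subspace_carrier: "subspace H"
    and ip_add_left: "\<lbrakk>x \<in> H; y \<in> H; z \<in> H\<rbrakk> \<Longrightarrow> ip (x + y) z = ip x z + ip y z"
    and ip_scale_left: "\<lbrakk>x \<in> H; y \<in> H\<rbrakk> \<Longrightarrow> ip (smul c x) y = c * ip x y"
    and ip_cnj: "\<lbrakk>x \<in> H; y \<in> H\<rbrakk> \<Longrightarrow> ip y x = cnj (ip x y)"
    and ip_pos: "\<lbrakk>x \<in> H; x \<noteq> 0\<rbrakk> \<Longrightarrow> 0 < Re (ip x x)"
    and complete_carrier:
      "\<lbrakk>\<And>k::nat. X k \<in> H;
        \<forall>e>0. \<exists>N. \<forall>k\<ge>N. \<forall>m\<ge>N. ip_norm ip (X k - X m) < e\<rbrakk>
       \<Longrightarrow> \<exists>x\<in>H. (\<lambda>k. ip_norm ip (X k - x)) \<longlonglongrightarrow> 0"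

definition bounded_operator_on ::
  "(complex \<Rightarrow> 'a::ab_group_add \<Rightarrow> 'a) \<Rightarrow> 'a set \<Rightarrow> ('a \<Rightarrow> 'a \<Rightarrow> complex) \<Rightarrow> ('a \<Rightarrow> 'a) \<Rightarrow> bool" where
  "bounded_operator_on smul H ip T \<longleftrightarrow>
     T ` H \<subseteq> H \<and>
     (\<forall>x\<in>H. \<forall>y\<in>H. T (x + y) = T x + T y) \<and>
     (\<forall>c. \<forall>x\<in>H. T (smul c x) = smul c (T x)) \<and>
     (\<exists>K. \<forall>x\<in>H. ip_norm ip (T x) \<le> K * ip_norm ip x)"

text \<open>
  The Hilbert space adjoint: for a bounded operator on a Hilbert space the described element
  exists and is unique, by the Riesz representation theorem.
\<close>

definition adjoint_on :: "'a set \<Rightarrow> ('a \<Rightarrow> 'a \<Rightarrow> complex) \<Rightarrow> ('a \<Rightarrow> 'a) \<Rightarrow> 'a \<Rightarrow> 'a" where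
  "adjoint_on H ip T y = (THE w. w \<in> H \<and> (\<forall>x\<in>H. ip (T x) y = ip x w))"

definition near_isometry_on ::
  "(complex \<Rightarrow> 'a::ab_group_add \<Rightarrow> 'a) \<Rightarrow> 'a set \<Rightarrow> ('a \<Rightarrow> 'a \<Rightarrow> complex) \<Rightarrow> ('a \<Rightarrow> 'a) \<Rightarrow> bool" where
  "near_isometry_on smul H ip T \<longleftrightarrow>
     bounded_operator_on smul H ip T \<and>
     (\<exists>\<delta>>0. \<forall>x\<in>H. \<delta> * ip_norm ip x \<le> ip_norm ip (T x) \<and> ip_norm ip (T x) \<le> ip_norm ip x) \<and>
     (\<forall>k\<ge>1. (\<lambda>x. (adjoint_on H ip T ^^ k) ((T ^^ (k + 1)) x)) ` H \<subseteq> T ` H)"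

definition doubly_commuting_on ::
  "'a set \<Rightarrow> ('a \<Rightarrow> 'a \<Rightarrow> complex) \<Rightarrow> ('i \<Rightarrow> 'a \<Rightarrow> 'a) \<Rightarrow> bool" where
  "doubly_commuting_on H ip T \<longleftrightarrow>
     (\<forall>i j. \<forall>x\<in>H. T i (T j x) = T j (T i x)) \<and>
     (\<forall>i j. i \<noteq> j \<longrightarrow>
        (\<forall>x\<in>H. T i (adjoint_on H ip (T j) x) = adjoint_on H ip (T j) (T i x)))"


section \<open>Hardy spaces of the polydisc\<close>

definition polydisc :: "(complex ^ 'n::finite) set" where
  "polydisc = {z. \<forall>i. norm (z $ i) < 1}"

text \<open>Complex differentiability in several variables: the Frechet derivative is complex-linear.\<close>

definition analytic_on_polydisc :: "(complex ^ 'n::finite \<Rightarrow> complex) \<Rightarrow> bool" where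
  "analytic_on_polydisc f \<longleftrightarrow>
     (\<forall>z\<in>polydisc. \<exists>f'. (f has_derivative f') (at z) \<and> (\<forall>c v. f' (c *s v) = c * f' v))"

text \<open>
  The \<open>p\<close>-th power of the \<open>L\<^sup>p\<close> norm of \<open>f\<close> on the torus of radius \<open>r\<close>,
  with respect to normalized Lebesgue measure.
\<close>

definition torus_mean :: "real \<Rightarrow> (complex ^ 'n::finite \<Rightarrow> complex) \<Rightarrow> real \<Rightarrow> ennreal" where
  "torus_mean p f r =
     (\<integral>\<^sup>+\<theta>\<in>cbox 0 (\<chi> j. 2 * pi).
        ennreal (norm (f (\<chi> j. complex_of_real r * cis (\<theta> $ j))) powr p) \<partial>(lborel :: (real ^ 'n) measure))
     / ennreal ((2 * pi) ^ CARD('n))"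

text \<open>
  A function on the polydisc is represented by its extension by zero to all of \<open>complex ^ 'n\<close>,
  so that equality of elements of the Hardy space is equality on the polydisc.
\<close>

definition hardy_space :: "ennreal \<Rightarrow> (complex ^ 'n::finite \<Rightarrow> complex) set" where
  "hardy_space p =
     {f. analytic_on_polydisc f \<and> (\<forall>z. z \<notin> polydisc \<longrightarrow> f z = 0) \<and>
         (if p = \<infinity> then bounded (f ` polydisc)
          else (SUP r\<in>{0..<1}. torus_mean (enn2real p) f r) < \<infinity>)}"

definition fun_scale :: "complex \<Rightarrow> ('b \<Rightarrow> complex) \<Rightarrow> 'b \<Rightarrow> complex" where
  "fun_scale c f = (\<lambda>z. c * f z)"

lemma vector_space_fun_scale: "vector_space fun_scale"
  by unfold_locales (auto simp: fun_scale_def fun_eq_iff algebra_simps)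


section \<open>Blaschke products and multiplication operators\<close>

definition finite_blaschke :: "nat \<Rightarrow> (nat \<Rightarrow> complex) \<Rightarrow> complex \<Rightarrow> complex" where
  "finite_blaschke r \<alpha> z = (\<Prod>l=1..r. (z - \<alpha> l) / (1 - cnj (\<alpha> l) * z))"

definition coord_mult :: "('n \<Rightarrow> complex \<Rightarrow> complex) \<Rightarrow> 'n \<Rightarrow> (complex ^ 'n \<Rightarrow> complex) \<Rightarrow> complex ^ 'n \<Rightarrow> complex" where
  "coord_mult B i f = (\<lambda>z. B i (z $ i) * f z)"

end

theory Submission
  imports Defs "HOL-Complex_Analysis.Conformal_Mappings"
begin

text \<open>
  Fix one coordinate \<open>i\<close> and let \<open>T\<close> be multiplication by \<open>b = B i (z $ i)\<close>.  If \<open>T\<close> mapped \<open>M\<close> onto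
  itself, every element of \<open>M\<close> would be divisible by all powers of \<open>b\<close>, hence vanish to infinite order
  at a zero of \<open>B i\<close>, hence be 0.  So a nonzero \<open>M\<close> contains some \<open>e \<noteq> 0\<close> orthogonal to the (closed)
  range of \<open>T\<close>.

  Condition (ii) of a near-isometry makes the orbit \<open>e, T e, T\<^sup>2 e, \<dots>\<close> orthogonal
  (\<open>near_isometry_wandering_orthogonal\<close>), and it is bounded since \<open>T\<close> is a contraction.
  Hence \<open>\<Sum>k. c k * T^k e\<close> converges in \<open>M\<close> for every square-summable \<open>c\<close>.  The norm of \<open>M\<close> need not control point values, but the sum differs
  from its \<open>m\<close>-th partial sum by an element of the range of \<open>T^m\<close>; comparing orders of vanishing at a
  zero of \<open>B i\<close> identifies it with the function \<open>e * g(b)\<close>, where \<open>g(x) = \<Sum>k. c k * x^k\<close>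
  (\<open>series_tails_determine_function\<close>).  Thus \<open>e * g(b)\<close> lies in \<open>H\<^sup>p\<close> for \<^emph>\<open>every\<close> \<open>g\<close> in the
  Hardy space \<open>H\<^sup>2\<close> of the disc.

  For \<open>p > 2\<close> this forces \<open>e = 0\<close>.  Functions in \<open>H\<^sup>p\<close> grow at most like \<open>(1 - \<bar>z $ i\<bar>) powr (-1/p)\<close>
  when the other coordinates are fixed (\<open>hardy_space_growth\<close>, a Poisson estimate iterated over the
  coordinates).  By uniform boundedness (\<open>evaluations_uniformly_bounded\<close>) the supremum over the unit
  ball of \<open>H\<^sup>2\<close> may be taken in this bound for \<open>e * g(b)\<close>.  Evaluation at a point \<open>x\<close> has norm
  \<open>1 / sqrt (1 - \<bar>x\<bar>\<^sup>2)\<close> on \<open>H\<^sup>2\<close>, and \<open>1 - \<bar>b\<bar>\<^sup>2\<close> is at most a multiple of \<open>1 - \<bar>z $ i\<bar>\<close>.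
  Therefore \<open>e\<close> is at most a multiple of \<open>(1 - \<bar>z $ i\<bar>) powr (1/2 - 1/p)\<close> and tends to 0 at the
  boundary in the variable \<open>z $ i\<close>; by the maximum principle it vanishes.
\<close>

section \<open>Orthogonal projections and adjoints\<close>

context complex_hilbert_space
begin

lemma carrier_closed:
  shows zero_carrier: "0 \<in> H"
    and add_carrier: "\<lbrakk>x \<in> H; y \<in> H\<rbrakk> \<Longrightarrow> x + y \<in> H"
    and diff_carrier: "\<lbrakk>x \<in> H; y \<in> H\<rbrakk> \<Longrightarrow> x - y \<in> H"
    and scale_carrier: "x \<in> H \<Longrightarrow> smul c x \<in> H"
  using subspace_carrier subspace_0 subspace_add subspace_diff subspace_scale by blast+

lemma sum_carrier: "(\<And>k. k \<in> A \<Longrightarrow> f k \<in> H) \<Longrightarrow> sum f A \<in> H"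
  using subspace_carrier by (rule subspace_sum)

lemma ip_add_right:
  assumes "x \<in> H" "y \<in> H" "z \<in> H" shows "ip x (y + z) = ip x y + ip x z"
  using ip_cnj[of "y + z" x] ip_cnj[of y x] ip_cnj[of z x] ip_add_left[of y z x] assms
  by (simp add: carrier_closed)

lemma ip_scale_right:
  assumes "x \<in> H" "y \<in> H" shows "ip x (smul c y) = cnj c * ip x y"
  using ip_cnj[of "smul c y" x] ip_cnj[of y x] ip_scale_left[of y x c] assms
  by (simp add: carrier_closed)

lemma ip_diff_left:
  assumes "x \<in> H" "y \<in> H" "z \<in> H" shows "ip (x - y) z = ip x z - ip y z"
  using ip_add_left[of "x - y" y z] assms by (simp add: carrier_closed)

lemma ip_diff_right:
  assumes "x \<in> H" "y \<in> H" "z \<in> H" shows "ip x (y - z) = ip x y - ip x z"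
  using ip_add_right[of x "y - z" z] assms by (simp add: carrier_closed)

lemma ip_zero_left: "x \<in> H \<Longrightarrow> ip 0 x = 0"
  using ip_add_left[of 0 0 x] by (simp add: carrier_closed)

lemma ip_zero_right: "x \<in> H \<Longrightarrow> ip x 0 = 0"
  using ip_add_right[of x 0 0] by (simp add: carrier_closed)

lemma ip_self_nonneg: "x \<in> H \<Longrightarrow> 0 \<le> Re (ip x x)"
  using ip_pos[of x] ip_zero_left[of 0] zero_carrier by (cases "x = 0") auto

lemma ip_norm_nonneg: "x \<in> H \<Longrightarrow> 0 \<le> ip_norm ip x"
  by (simp add: ip_norm_def ip_self_nonneg)

lemma ip_norm_sq: "x \<in> H \<Longrightarrow> (ip_norm ip x)\<^sup>2 = Re (ip x x)"
  by (simp add: ip_norm_def ip_self_nonneg)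

lemma ip_self: "x \<in> H \<Longrightarrow> ip x x = complex_of_real ((ip_norm ip x)\<^sup>2)"
  using ip_cnj[of x x] by (simp add: ip_norm_sq complex_eq_iff)

lemma ip_norm_eq_0: "x \<in> H \<Longrightarrow> ip_norm ip x = 0 \<longleftrightarrow> x = 0"
  using ip_pos[of x] ip_zero_left[of 0] zero_carrier by (cases "x = 0") (auto simp: ip_norm_def)

lemma ip_norm_zero: "ip_norm ip 0 = 0"
  using ip_norm_eq_0[of 0] zero_carrier by simp

lemma ip_norm_add_sq:
  assumes "x \<in> H" "y \<in> H"
  shows "(ip_norm ip (x + y))\<^sup>2 = (ip_norm ip x)\<^sup>2 + 2 * Re (ip x y) + (ip_norm ip y)\<^sup>2"
  using assms ip_cnj[of x y] by (simp add: ip_norm_sq carrier_closed ip_add_left ip_add_right)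

lemma ip_norm_diff_sq:
  assumes "x \<in> H" "y \<in> H"
  shows "(ip_norm ip (x - y))\<^sup>2 = (ip_norm ip x)\<^sup>2 - 2 * Re (ip x y) + (ip_norm ip y)\<^sup>2"
  using assms ip_cnj[of x y] by (simp add: ip_norm_sq carrier_closed ip_diff_left ip_diff_right)

lemma ip_norm_scale: "x \<in> H \<Longrightarrow> ip_norm ip (smul c x) = norm c * ip_norm ip x"
proof -
  assume x: "x \<in> H"
  have "ip (smul c x) (smul c x) = complex_of_real ((norm c)\<^sup>2 * (ip_norm ip x)\<^sup>2)"
    using x by (simp add: ip_scale_left ip_scale_right carrier_closed ip_self[OF x] complex_norm_square mult_ac
        del: of_real_power)
  then have "(ip_norm ip (smul c x))\<^sup>2 = (norm c * ip_norm ip x)\<^sup>2"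
    using x by (simp add: ip_norm_sq carrier_closed power_mult_distrib)
  then show ?thesis
    using x by (meson ip_norm_nonneg mult_nonneg_nonneg norm_ge_zero power2_eq_imp_eq scale_carrier)
qed

lemma ip_norm_minus: "\<lbrakk>x \<in> H; y \<in> H\<rbrakk> \<Longrightarrow> ip_norm ip (x - y) = ip_norm ip (y - x)"
  using ip_norm_scale[of "x - y" "- 1"] by (simp add: carrier_closed)

lemma Cauchy_Schwarz_Re:
  assumes x: "x \<in> H" and y: "y \<in> H"
  shows "Re (ip x y) \<le> ip_norm ip x * ip_norm ip y"
proof (cases "x = 0 \<or> y = 0")
  case True
  then show ?thesis using x y by (auto simp: ip_zero_left ip_zero_right ip_norm_zero)
next
  case False
  let ?a = "ip_norm ip x" and ?b = "ip_norm ip y"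
  have pos: "?a > 0" "?b > 0"
    using False x y by (metis ip_norm_eq_0 ip_norm_nonneg less_eq_real_def)+
  have "0 \<le> (ip_norm ip (smul (of_real ?b) x - smul (of_real ?a) y))\<^sup>2" by simp
  also have "\<dots> = 2 * ?a * ?b * (?a * ?b - Re (ip x y))"
    using x y pos by (subst ip_norm_diff_sq)
      (auto simp: carrier_closed ip_scale_left ip_scale_right ip_norm_scale power2_eq_square algebra_simps)
  finally have "0 \<le> (?a * ?b) * (?a * ?b - Re (ip x y))" by simp
  then show ?thesis using mult_pos_pos[OF pos] zero_le_mult_iff[of "?a * ?b"] by force
qed

lemma ip_norm_triangle:
  assumes "x \<in> H" "y \<in> H"
  shows "ip_norm ip (x + y) \<le> ip_norm ip x + ip_norm ip y"
proof (rule power2_le_imp_le)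
  show "(ip_norm ip (x + y))\<^sup>2 \<le> (ip_norm ip x + ip_norm ip y)\<^sup>2"
    using assms Cauchy_Schwarz_Re[of x y] by (simp add: ip_norm_add_sq power2_sum algebra_simps)
qed (use assms ip_norm_nonneg in auto)

lemma ip_norm_triangle_diff:
  assumes "x \<in> H" "y \<in> H" "z \<in> H"
  shows "ip_norm ip (x - z) \<le> ip_norm ip (x - y) + ip_norm ip (y - z)"
  using ip_norm_triangle[of "x - y" "y - z"] assms by (simp add: carrier_closed)

lemma Cauchy_Schwarz:
  assumes x: "x \<in> H" and y: "y \<in> H"
  shows "norm (ip x y) \<le> ip_norm ip x * ip_norm ip y"
proof (cases "ip x y = 0")
  case True
  then show ?thesis using x y by (simp add: ip_norm_nonneg)
next
  case False
  let ?u = "cnj (ip x y) / of_real (norm (ip x y))"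
  have "ip (smul ?u x) y = of_real (norm (ip x y))"
    using x y False by (simp add: ip_scale_left field_simps complex_norm_square[symmetric] power2_eq_square)
  moreover have "norm ?u = 1" using False by (simp add: norm_divide)
  ultimately show ?thesis
    using Cauchy_Schwarz_Re[of "smul ?u x" y] x y ip_norm_scale[of x ?u] by (simp add: carrier_closed)
qed

lemma limit_unique:
  assumes "\<And>k. X k \<in> H" "x \<in> H" "y \<in> H"
    and "(\<lambda>k. ip_norm ip (X k - x)) \<longlonglongrightarrow> 0" "(\<lambda>k. ip_norm ip (X k - y)) \<longlonglongrightarrow> 0"
  shows "x = y"
proof -
  have "(\<lambda>k. ip_norm ip (X k - x) + ip_norm ip (X k - y)) \<longlonglongrightarrow> 0"
    using tendsto_add[OF assms(4,5)] by simp
  moreover have "ip_norm ip (x - y) \<le> ip_norm ip (X k - x) + ip_norm ip (X k - y)" for k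
    using ip_norm_triangle_diff[of x "X k" y] ip_norm_minus[of x "X k"] assms by simp
  ultimately have "ip_norm ip (x - y) \<le> 0"
    using tendsto_lowerbound[of _ 0 sequentially "ip_norm ip (x - y)"] by simp
  then show ?thesis
    using ip_norm_nonneg[of "x - y"] ip_norm_eq_0[of "x - y"] assms by (simp add: carrier_closed)
qed

text \<open>
  A minimizing sequence for the distance to the subspace is Cauchy by the parallelogram law.
\<close>

lemma orthogonal_projection_exists:
  assumes S: "subspace S" "S \<subseteq> H" and x: "x \<in> H"
    and closed: "\<And>X y. \<lbrakk>\<And>k::nat. X k \<in> S; y \<in> H; (\<lambda>k. ip_norm ip (X k - y)) \<longlonglongrightarrow> 0\<rbrakk> \<Longrightarrow> y \<in> S"
  shows "\<exists>y\<in>S. \<forall>s\<in>S. ip (x - y) s = 0"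
proof -
  let ?D = "(\<lambda>s. (ip_norm ip (x - s))\<^sup>2) ` S"
  define d where "d = Inf ?D"
  have bdd: "bdd_below ?D" by (rule bdd_belowI2[where m = 0]) simp
  have ne: "?D \<noteq> {}" using subspace_0[OF S(1)] by auto
  have d_le: "d \<le> (ip_norm ip (x - s))\<^sup>2" if "s \<in> S" for s
    unfolding d_def using bdd that by (simp add: cInf_lower)
  have "\<exists>s. s \<in> S \<and> (ip_norm ip (x - s))\<^sup>2 < d + 1 / real (Suc k)" for k
    using cInf_lessD[OF ne, of "d + 1 / real (Suc k)"] by (auto simp: d_def)
  then have "\<exists>X. \<forall>k. X k \<in> S \<and> (ip_norm ip (x - X k))\<^sup>2 < d + 1 / real (Suc k)"
    by (intro choice allI)
  then obtain X where X: "\<And>k. X k \<in> S" and X_lt: "\<And>k. (ip_norm ip (x - X k))\<^sup>2 < d + 1 / real (Suc k)"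
    by blast
  have XH: "X k \<in> H" for k using X S by blast
  have par: "(ip_norm ip (X k - X m))\<^sup>2 \<le> 2 * (1 / real (Suc k)) + 2 * (1 / real (Suc m))" for k m
  proof -
    let ?h = "smul (1/2) (X k + X m)"
    have h: "?h \<in> S" using X S by (simp add: subspace_add subspace_scale)
    let ?a = "x - X k" and ?b = "x - X m"
    have aH: "?a \<in> H" "?b \<in> H" using x XH by (auto simp: carrier_closed)
    have "?a + ?b = smul 2 (x - ?h)"
    proof -
      have "smul 2 (x - ?h) = smul 2 x - (X k + X m)"
        by (simp add: scale_right_diff_distrib)
      also have "smul 2 x = x + x"
        using scale_left_distrib[of 1 1 x] by simp
      finally show ?thesis by (simp add: algebra_simps)
    qed
    then have "(ip_norm ip (?a + ?b))\<^sup>2 = 4 * (ip_norm ip (x - ?h))\<^sup>2"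
      using x h S by (simp add: ip_norm_scale carrier_closed subset_iff power_mult_distrib)
    moreover have "?b - ?a = X k - X m" by simp
    moreover have "(ip_norm ip (?a + ?b))\<^sup>2 + (ip_norm ip (?b - ?a))\<^sup>2
        = 2 * (ip_norm ip ?a)\<^sup>2 + 2 * (ip_norm ip ?b)\<^sup>2"
      unfolding ip_norm_add_sq[OF aH] ip_norm_diff_sq[OF aH(2,1)] using ip_cnj[OF aH] by simp
    ultimately have "(ip_norm ip (X k - X m))\<^sup>2
        = 2 * (ip_norm ip ?a)\<^sup>2 + 2 * (ip_norm ip ?b)\<^sup>2 - 4 * (ip_norm ip (x - ?h))\<^sup>2"
      by (simp only:)
    then show ?thesis
      using d_le[OF h] X_lt[of k] X_lt[of m] by linarith
  qed
  have "\<exists>y\<in>H. (\<lambda>k. ip_norm ip (X k - y)) \<longlonglongrightarrow> 0"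
  proof (rule complete_carrier[OF XH], intro allI impI)
    fix \<epsilon> :: real assume \<epsilon>: "\<epsilon> > 0"
    then have "\<epsilon>\<^sup>2 / 4 > 0" by simp
    then obtain N where N: "inverse (real (Suc N)) < \<epsilon>\<^sup>2 / 4"
      using reals_Archimedean by blast
    have "ip_norm ip (X k - X m) < \<epsilon>" if "k \<ge> N" "m \<ge> N" for k m
    proof -
      have "1 / real (Suc k) \<le> inverse (real (Suc N))" "1 / real (Suc m) \<le> inverse (real (Suc N))"
        using that by (auto simp: divide_inverse)
      then have "(ip_norm ip (X k - X m))\<^sup>2 < \<epsilon>\<^sup>2"
        using par[of k m] N by linarith
      then show ?thesis using \<epsilon> by (simp add: power2_less_imp_less)
    qed
    then show "\<exists>N. \<forall>k\<ge>N. \<forall>m\<ge>N. ip_norm ip (X k - X m) < \<epsilon>" by blast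
  qed
  then obtain y where y: "y \<in> H" "(\<lambda>k. ip_norm ip (X k - y)) \<longlonglongrightarrow> 0" by blast
  have yS: "y \<in> S" using closed[OF X y] .
  have min: "(ip_norm ip (x - y))\<^sup>2 \<le> d"
  proof (rule tendsto_lowerbound)
    show "(\<lambda>k. (sqrt (d + 1 / real (Suc k)) + ip_norm ip (X k - y))\<^sup>2) \<longlonglongrightarrow> d"
    proof -
      have "d \<ge> 0" unfolding d_def using ne by (intro cInf_greatest) auto
      moreover have "(\<lambda>k. (sqrt (d + 1 / real (Suc k)) + ip_norm ip (X k - y))\<^sup>2)
           \<longlonglongrightarrow> (sqrt (d + 0) + 0)\<^sup>2"
        by (intro tendsto_power tendsto_add tendsto_real_sqrt tendsto_const y(2) LIMSEQ_Suc[OF lim_1_over_n])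
      ultimately show ?thesis by simp
    qed
    show "\<forall>\<^sub>F k in sequentially. (ip_norm ip (x - y))\<^sup>2 \<le> (sqrt (d + 1 / real (Suc k)) + ip_norm ip (X k - y))\<^sup>2"
    proof (intro always_eventually allI power_mono)
      fix k
      have "ip_norm ip (x - X k) \<le> sqrt (d + 1 / real (Suc k))"
        using X_lt[of k] by (intro real_le_rsqrt) simp
      then show "ip_norm ip (x - y) \<le> sqrt (d + 1 / real (Suc k)) + ip_norm ip (X k - y)"
        using ip_norm_triangle_diff[of x "X k" y] x XH y by simp
      show "0 \<le> ip_norm ip (x - y)" using x y by (simp add: ip_norm_nonneg carrier_closed)
    qed
  qed simp
  have "ip (x - y) s = 0" if s: "s \<in> S" for s
  proof (rule ccontr)
    let ?a = "ip (x - y) s"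
    assume a: "?a \<noteq> 0"
    have sH: "s \<in> H" and uH: "x - y \<in> H" using s S x y by (auto simp: carrier_closed)
    have key: "2 \<le> t * (ip_norm ip s)\<^sup>2" if "t > 0" for t :: real
    proof -
      let ?c = "of_real t * ?a"
      have "y + smul ?c s \<in> S" using yS s S by (simp add: subspace_add subspace_scale)
      from d_le[OF this] min
      have "(ip_norm ip (x - y))\<^sup>2 \<le> (ip_norm ip ((x - y) - smul ?c s))\<^sup>2"
        by (simp add: algebra_simps)
      also have "\<dots> = (ip_norm ip (x - y))\<^sup>2 - 2 * t * (norm ?a)\<^sup>2 + t\<^sup>2 * (norm ?a)\<^sup>2 * (ip_norm ip s)\<^sup>2"
      proof -
        have "Re (cnj ?c * ?a) = t * (norm ?a)\<^sup>2"
          unfolding cmod_power2 by (simp add: power2_eq_square algebra_simps)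
        then show ?thesis
          using sH uH that
          by (simp add: ip_norm_diff_sq[of "x - y"] carrier_closed ip_scale_right ip_norm_scale norm_mult power_mult_distrib)
      qed
      finally have "0 \<le> (t * (norm ?a)\<^sup>2) * (t * (ip_norm ip s)\<^sup>2 - 2)"
        by (simp add: power2_eq_square algebra_simps)
      moreover have "t * (norm ?a)\<^sup>2 > 0" using that a by simp
      ultimately show ?thesis by (simp add: zero_le_mult_iff)
    qed
    have "1 + (ip_norm ip s)\<^sup>2 > 0" by (simp add: add_pos_nonneg)
    then show False
      using key[of "1 / (1 + (ip_norm ip s)\<^sup>2)"] by (simp add: pos_le_divide_eq)
  qed
  then show ?thesis using yS by blast
qed

text \<open>
  Off its kernel, a bounded functional is determined by one vector orthogonal to the kernel; the
  representing element is the appropriate multiple of that vector.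
\<close>

lemma Riesz_representation:
  fixes \<phi> :: "'a \<Rightarrow> complex"
  assumes add: "\<And>x y. \<lbrakk>x \<in> H; y \<in> H\<rbrakk> \<Longrightarrow> \<phi> (x + y) = \<phi> x + \<phi> y"
    and scale: "\<And>c x. x \<in> H \<Longrightarrow> \<phi> (smul c x) = c * \<phi> x"
    and bounded: "\<And>x. x \<in> H \<Longrightarrow> norm (\<phi> x) \<le> K * ip_norm ip x"
  shows "\<exists>w\<in>H. \<forall>x\<in>H. \<phi> x = ip x w"
proof (cases "\<forall>x\<in>H. \<phi> x = 0")
  case True
  then show ?thesis using zero_carrier ip_zero_right by (intro bexI[of _ 0]) auto
next
  case False
  then obtain x0 where x0: "x0 \<in> H" "\<phi> x0 \<noteq> 0" by blast
  have diff: "\<phi> (x - y) = \<phi> x - \<phi> y" if "x \<in> H" "y \<in> H" for x y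
    using add[of "x - y" y] that by (simp add: carrier_closed)
  define S where "S = {x \<in> H. \<phi> x = 0}"
  have "\<phi> 0 = 0" using add[of 0 0] zero_carrier by simp
  then have sub: "subspace S"
    unfolding S_def subspace_def by (auto simp: carrier_closed add scale)
  have "\<exists>y\<in>S. \<forall>s\<in>S. ip (x0 - y) s = 0"
  proof (rule orthogonal_projection_exists[OF sub _ x0(1)])
    fix X y assume X: "\<And>k::nat. X k \<in> S" and y: "y \<in> H" and lim: "(\<lambda>k. ip_norm ip (X k - y)) \<longlonglongrightarrow> 0"
    have "norm (\<phi> y) \<le> K * ip_norm ip (X k - y)" for k
      using bounded[of "X k - y"] diff[of "X k" y] X[of k] y by (auto simp: S_def carrier_closed)
    moreover have "(\<lambda>k. K * ip_norm ip (X k - y)) \<longlonglongrightarrow> K * 0"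
      by (intro tendsto_intros lim)
    ultimately have "norm (\<phi> y) \<le> 0" using tendsto_lowerbound[of _ 0 sequentially "norm (\<phi> y)"] by simp
    then show "y \<in> S" using y by (simp add: S_def)
  qed (auto simp: S_def)
  then obtain y where y: "y \<in> S" and orth: "\<And>s. s \<in> S \<Longrightarrow> ip (x0 - y) s = 0" by blast
  define u where "u = x0 - y"
  have u: "u \<in> H" "\<phi> u \<noteq> 0" using x0 y diff by (auto simp: u_def S_def carrier_closed)
  then have "u \<noteq> 0" using \<open>\<phi> 0 = 0\<close> by auto
  then have nz: "ip u u \<noteq> 0" using ip_pos[OF u(1)] by auto
  let ?w = "smul (cnj (\<phi> u / ip u u)) u"
  have "\<phi> x = ip x ?w" if x: "x \<in> H" for x
  proof -
    have "x - smul (\<phi> x / \<phi> u) u \<in> S"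
      using x u by (simp add: S_def carrier_closed diff scale)
    then have "ip (x - smul (\<phi> x / \<phi> u) u) u = 0"
      using orth[of "x - smul (\<phi> x / \<phi> u) u"] ip_cnj[of u "x - smul (\<phi> x / \<phi> u) u"] x u
      by (simp add: u_def[symmetric] carrier_closed)
    then have "ip x u = \<phi> x / \<phi> u * ip u u"
      using x u by (simp add: ip_diff_left ip_scale_left carrier_closed)
    then show ?thesis using x u nz by (simp add: ip_scale_right)
  qed
  then show ?thesis using u scale_carrier by blast
qed

text \<open>
  For a bounded \<open>T\<close> the functional \<open>x \<mapsto> ip (T x) y\<close> is bounded, so its Riesz
  representative is the element described in \<open>adjoint_on\<close>.
\<close>

lemma adjoint_on_works:
  assumes T: "bounded_operator_on smul H ip T" and y: "y \<in> H"
  shows "adjoint_on H ip T y \<in> H" "\<And>x. x \<in> H \<Longrightarrow> ip (T x) y = ip x (adjoint_on H ip T y)"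
proof -
  from T have TH: "\<And>x. x \<in> H \<Longrightarrow> T x \<in> H"
    and Tadd: "\<And>x y. \<lbrakk>x \<in> H; y \<in> H\<rbrakk> \<Longrightarrow> T (x + y) = T x + T y"
    and Tscale: "\<And>c x. x \<in> H \<Longrightarrow> T (smul c x) = smul c (T x)"
    by (auto simp: bounded_operator_on_def)
  from T have "\<exists>K. \<forall>x\<in>H. ip_norm ip (T x) \<le> K * ip_norm ip x"
    by (simp add: bounded_operator_on_def)
  then obtain K where K: "\<And>x. x \<in> H \<Longrightarrow> ip_norm ip (T x) \<le> K * ip_norm ip x"
    by blast
  have "\<exists>w\<in>H. \<forall>x\<in>H. ip (T x) y = ip x w"
  proof (rule Riesz_representation)
    show "norm (ip (T x) y) \<le> (K * ip_norm ip y) * ip_norm ip x" if "x \<in> H" for x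
      using Cauchy_Schwarz[of "T x" y] mult_right_mono[OF K[OF that] ip_norm_nonneg[OF y]] that TH y
      by (simp add: mult_ac)
  qed (use TH Tadd Tscale y in \<open>auto simp: ip_add_left ip_scale_left\<close>)
  then obtain w where w: "w \<in> H" "\<forall>x\<in>H. ip (T x) y = ip x w" by blast
  have "\<exists>!w. w \<in> H \<and> (\<forall>x\<in>H. ip (T x) y = ip x w)"
  proof (rule ex1I[of _ w])
    fix v assume v: "v \<in> H \<and> (\<forall>x\<in>H. ip (T x) y = ip x v)"
    then have "v - w \<in> H" using w diff_carrier by blast
    then have "ip (v - w) v = ip (v - w) w" using v w by force
    then have "ip (v - w) (v - w) = 0"
      using v w by (simp add: ip_diff_right carrier_closed)
    then show "v = w" using ip_pos[of "v - w"] v w by (auto simp: carrier_closed)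
  qed (use w in blast)
  from theI'[OF this] have "adjoint_on H ip T y \<in> H \<and> (\<forall>x\<in>H. ip (T x) y = ip x (adjoint_on H ip T y))"
    unfolding adjoint_on_def .
  then show "adjoint_on H ip T y \<in> H" "\<And>x. x \<in> H \<Longrightarrow> ip (T x) y = ip x (adjoint_on H ip T y)"
    by simp_all
qed

section \<open>Wandering vectors of near-isometries\<close>

lemma bounded_operator_onD:
  assumes "bounded_operator_on smul H ip T"
  shows "\<And>x. x \<in> H \<Longrightarrow> T x \<in> H"
    and "\<And>x y. \<lbrakk>x \<in> H; y \<in> H\<rbrakk> \<Longrightarrow> T (x + y) = T x + T y"
    and "\<And>c x. x \<in> H \<Longrightarrow> T (smul c x) = smul c (T x)"
    and "\<And>x y. \<lbrakk>x \<in> H; y \<in> H\<rbrakk> \<Longrightarrow> T (x - y) = T x - T y"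
    and "\<And>x k. x \<in> H \<Longrightarrow> (T ^^ k) x \<in> H"
proof -
  show TH: "T x \<in> H" if "x \<in> H" for x using assms that by (auto simp: bounded_operator_on_def)
  show add: "T (x + y) = T x + T y" if "x \<in> H" "y \<in> H" for x y
    using assms that by (simp add: bounded_operator_on_def)
  show "T (smul c x) = smul c (T x)" if "x \<in> H" for c x
    using assms that by (simp add: bounded_operator_on_def)
  show "T (x - y) = T x - T y" if "x \<in> H" "y \<in> H" for x y
    using add[of "x - y" y] that by (simp add: carrier_closed)
  show "(T ^^ k) x \<in> H" if "x \<in> H" for x k
    using that by (induction k) (auto simp: TH)
qed

lemma adjoint_on_power:
  assumes T: "bounded_operator_on smul H ip T" and y: "y \<in> H"
  shows "(adjoint_on H ip T ^^ k) y \<in> H"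
    and "x \<in> H \<Longrightarrow> ip ((T ^^ k) x) y = ip x ((adjoint_on H ip T ^^ k) y)"
proof -
  show mem: "(adjoint_on H ip T ^^ k) y \<in> H" for k
    using y by (induction k) (auto simp: adjoint_on_works(1)[OF T])
  show "ip ((T ^^ k) x) y = ip x ((adjoint_on H ip T ^^ k) y)" if "x \<in> H"
    using that
  proof (induction k arbitrary: x)
    case (Suc k)
    have "ip ((T ^^ Suc k) x) y = ip ((T ^^ k) (T x)) y" by (simp only: funpow_Suc_right comp_def)
    also have "\<dots> = ip (T x) ((adjoint_on H ip T ^^ k) y)"
      using Suc bounded_operator_onD(1)[OF T] by blast
    also have "\<dots> = ip x (adjoint_on H ip T ((adjoint_on H ip T ^^ k) y))"
      using adjoint_on_works(2)[OF T mem Suc.prems] .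
    finally show ?case by simp
  qed simp
qed

text \<open>
  This is where the second condition on a near-isometry enters: it moves the \<open>k\<close> factors \<open>T\<close> in
  front of \<open>e\<close> to the other side and lands in the range of \<open>T\<close>, to which \<open>e\<close> is orthogonal.
\<close>

lemma near_isometry_wandering_orthogonal:
  assumes T: "near_isometry_on smul H ip T" and e: "e \<in> H" and x: "x \<in> H"
    and wandering: "\<And>x. x \<in> H \<Longrightarrow> ip (T x) e = 0"
  shows "ip ((T ^^ Suc k) x) ((T ^^ k) e) = 0"
proof (cases k)
  case 0
  then show ?thesis using wandering[OF x] by simp
next
  case (Suc l)
  have bT: "bounded_operator_on smul H ip T" using T by (simp add: near_isometry_on_def)
  let ?A = "adjoint_on H ip T"
  have T'x: "(T ^^ Suc k) x \<in> H" and T'e: "(T ^^ k) e \<in> H"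
    using bounded_operator_onD(5)[OF bT] x e by blast+
  have "(\<lambda>x. (?A ^^ k) ((T ^^ (k + 1)) x)) ` H \<subseteq> T ` H"
  proof -
    have "\<forall>k\<ge>1. (\<lambda>x. (?A ^^ k) ((T ^^ (k + 1)) x)) ` H \<subseteq> T ` H"
      using T unfolding near_isometry_on_def by (elim conjE)
    moreover have "k \<ge> 1" using Suc by simp
    ultimately show ?thesis by blast
  qed
  then obtain y where y: "y \<in> H" "(?A ^^ k) ((T ^^ Suc k) x) = T y"
    using x by auto
  have "ip ((T ^^ k) e) ((T ^^ Suc k) x) = ip e (T y)"
    using adjoint_on_power(2)[OF bT T'x e] y by simp
  also have "\<dots> = 0"
    using ip_cnj[of "T y" e] wandering[OF y(1)] bounded_operator_onD(1)[OF bT] y e by simp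
  finally show ?thesis using ip_cnj[OF T'e T'x] by simp
qed

text \<open>
  Since \<open>T\<close> is bounded below, the preimages of a convergent sequence in the range form a Cauchy
  sequence.
\<close>

lemma near_isometry_range_closed:
  assumes T: "near_isometry_on smul H ip T"
    and X: "\<And>k::nat. X k \<in> T ` H" and y: "y \<in> H" and lim: "(\<lambda>k. ip_norm ip (X k - y)) \<longlonglongrightarrow> 0"
  shows "y \<in> T ` H"
proof -
  have bT: "bounded_operator_on smul H ip T" using T by (simp add: near_isometry_on_def)
  note TD = bounded_operator_onD[OF bT]
  from T have "\<exists>\<delta>>0. \<forall>x\<in>H. \<delta> * ip_norm ip x \<le> ip_norm ip (T x) \<and> ip_norm ip (T x) \<le> ip_norm ip x"
    by (simp add: near_isometry_on_def)
  then obtain \<delta> where \<delta>: "\<delta> > 0" and lower: "\<And>x. x \<in> H \<Longrightarrow> \<delta> * ip_norm ip x \<le> ip_norm ip (T x)"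
    and upper: "\<And>x. x \<in> H \<Longrightarrow> ip_norm ip (T x) \<le> ip_norm ip x" by blast
  from X have "\<exists>Z. \<forall>k. Z k \<in> H \<and> X k = T (Z k)" by (intro choice allI) blast
  then obtain Z where Z: "\<And>k. Z k \<in> H" "\<And>k. X k = T (Z k)" by blast
  have XH: "X k \<in> H" for k using Z TD by simp
  have "\<exists>z\<in>H. (\<lambda>k. ip_norm ip (Z k - z)) \<longlonglongrightarrow> 0"
  proof (rule complete_carrier[OF Z(1)], intro allI impI)
    fix \<epsilon> :: real assume "\<epsilon> > 0"
    then have "\<delta> * \<epsilon> / 2 > 0" using \<delta> by simp
    then obtain N where N: "\<And>k. k \<ge> N \<Longrightarrow> ip_norm ip (X k - y) < \<delta> * \<epsilon> / 2"
      using order_tendstoD(2)[OF lim] unfolding eventually_sequentially by blast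
    have "ip_norm ip (Z k - Z m) < \<epsilon>" if "k \<ge> N" "m \<ge> N" for k m
    proof -
      have "\<delta> * ip_norm ip (Z k - Z m) \<le> ip_norm ip (X k - X m)"
        using lower[of "Z k - Z m"] Z TD(4) by (simp add: carrier_closed)
      also have "\<dots> \<le> ip_norm ip (X k - y) + ip_norm ip (y - X m)"
        using XH y by (intro ip_norm_triangle_diff) auto
      also have "\<dots> < \<delta> * \<epsilon>"
        using N[OF that(1)] N[OF that(2)] ip_norm_minus[OF y XH[of m]] by linarith
      finally show ?thesis using \<delta> by simp
    qed
    then show "\<exists>N. \<forall>k\<ge>N. \<forall>m\<ge>N. ip_norm ip (Z k - Z m) < \<epsilon>" by blast
  qed
  then obtain z where z: "z \<in> H" "(\<lambda>k. ip_norm ip (Z k - z)) \<longlonglongrightarrow> 0" by blast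
  have "(\<lambda>k. ip_norm ip (X k - T z)) \<longlonglongrightarrow> 0"
  proof (rule tendsto_sandwich[OF _ _ tendsto_const z(2)])
    show "\<forall>\<^sub>F k in sequentially. 0 \<le> ip_norm ip (X k - T z)"
      using XH TD(1) z by (simp add: ip_norm_nonneg carrier_closed)
    show "\<forall>\<^sub>F k in sequentially. ip_norm ip (X k - T z) \<le> ip_norm ip (Z k - z)"
      using upper[of "Z _ - z"] Z z TD(4) by (simp add: carrier_closed)
  qed
  then have "y = T z" using limit_unique[of X, OF XH y TD(1)[OF z(1)] lim] by blast
  then show ?thesis using z by blast
qed

text \<open>
  Since the range is closed, a vector outside it has a nonzero component orthogonal to it.
\<close>

lemma near_isometry_wandering_vector_exists:
  assumes T: "near_isometry_on smul H ip T" and "T ` H \<noteq> H"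
  obtains e where "e \<in> H" "e \<noteq> 0" "\<And>x. x \<in> H \<Longrightarrow> ip (T x) e = 0"
proof -
  have bT: "bounded_operator_on smul H ip T" using T by (simp add: near_isometry_on_def)
  note TD = bounded_operator_onD[OF bT]
  have sub: "T ` H \<subseteq> H" using TD(1) by blast
  then obtain x where x: "x \<in> H" "x \<notin> T ` H" using assms(2) by blast
  have "T 0 = 0" using TD(4)[of 0 0] zero_carrier by simp
  have "subspace (T ` H)"
    unfolding subspace_def
  proof (intro conjI ballI allI)
    show "0 \<in> T ` H" using \<open>T 0 = 0\<close> zero_carrier by force
  next
    fix u v assume "u \<in> T ` H" "v \<in> T ` H"
    then obtain a b where "a \<in> H" "b \<in> H" "u = T a" "v = T b" by blast
    then show "u + v \<in> T ` H" using TD(2)[of a b] add_carrier[of a b] by force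
  next
    fix c u assume "u \<in> T ` H"
    then obtain a where "a \<in> H" "u = T a" by blast
    then show "smul c u \<in> T ` H" using TD(3)[of a c] scale_carrier[of a c] by force
  qed
  then obtain y where y: "y \<in> T ` H" "\<And>s. s \<in> T ` H \<Longrightarrow> ip (x - y) s = 0"
    using orthogonal_projection_exists[OF _ sub x(1)] near_isometry_range_closed[OF T] by blast
  have yH: "y \<in> H" using y sub by blast
  show thesis
  proof
    show "x - y \<in> H" using x yH by (simp add: carrier_closed)
    show "x - y \<noteq> 0" using x y by auto
    show "ip (T u) (x - y) = 0" if "u \<in> H" for u
      using y(2)[of "T u"] ip_cnj[of "x - y" "T u"] that TD(1) x yH by (simp add: carrier_closed)
  qed
qed

text \<open>
  The orbit of a wandering vector is orthogonal and bounded, so square-summable coefficients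
  give a Cauchy series.
\<close>

lemma near_isometry_wandering_series_converges:
  assumes T: "near_isometry_on smul H ip T" and e: "e \<in> H"
    and wandering: "\<And>x. x \<in> H \<Longrightarrow> ip (T x) e = 0"
    and c: "summable (\<lambda>k. (norm (c k))\<^sup>2)"
  shows "\<exists>F\<in>H. (\<lambda>n. ip_norm ip ((\<Sum>k<n. smul (c k) ((T ^^ k) e)) - F)) \<longlonglongrightarrow> 0"
proof -
  have bT: "bounded_operator_on smul H ip T" using T by (simp add: near_isometry_on_def)
  note TD = bounded_operator_onD[OF bT]
  from T have upper: "\<And>x. x \<in> H \<Longrightarrow> ip_norm ip (T x) \<le> ip_norm ip x"
    by (auto simp: near_isometry_on_def)
  define f where "f k = smul (c k) ((T ^^ k) e)" for k
  have fH: "f k \<in> H" for k using e TD(5) by (simp add: f_def carrier_closed)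
  have Te: "ip_norm ip ((T ^^ k) e) \<le> ip_norm ip e" for k
  proof (induction k)
    case (Suc k)
    then show ?case using upper[of "(T ^^ k) e"] TD(5)[OF e, of k] by simp
  qed simp
  have f_norm: "(ip_norm ip (f k))\<^sup>2 \<le> (norm (c k))\<^sup>2 * (ip_norm ip e)\<^sup>2" for k
    using Te[of k] TD(5)[OF e, of k]
    by (simp add: f_def ip_norm_scale power_mult_distrib mult_left_mono power_mono ip_norm_nonneg)
  have orth: "ip (f n) (f k) = 0" if "k < n" for k n
  proof -
    obtain l where "n = Suc (k + l)" using \<open>k < n\<close> less_iff_Suc_add by blast
    then have "(T ^^ n) e = (T ^^ Suc k) ((T ^^ l) e)" by (simp add: funpow_add)
    then have "ip ((T ^^ n) e) ((T ^^ k) e) = 0"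
      using near_isometry_wandering_orthogonal[OF T e _ wandering, of "(T ^^ l) e" k] TD(5)[OF e] by simp
    then show ?thesis
      using TD(5)[OF e, of n] TD(5)[OF e, of k] by (simp add: f_def ip_scale_left ip_scale_right carrier_closed)
  qed
  have sumH: "sum f A \<in> H" for A using fH by (rule sum_carrier)
  have orth_sum: "ip (\<Sum>k\<in>{m..<n}. f k) (f n) = 0" for m n
  proof -
    have "ip (sum f A) (f n) = 0" if "finite A" "\<forall>k\<in>A. k < n" for A
      using that
    proof (induction A rule: finite_induct)
      case (insert k A)
      have "ip (f k) (f n) = 0"
        using orth[of k n] ip_cnj[of "f n" "f k"] fH insert by simp
      then show ?case using insert by (simp add: ip_add_left fH sumH)
    qed (simp add: ip_zero_left fH)
    then show ?thesis by simp
  qed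
  \<comment> \<open>Pythagoras; powers of the contraction \<open>T\<close> do not increase the norm of \<open>e\<close>.\<close>
  have pyth: "(ip_norm ip (\<Sum>k\<in>{m..<n}. f k))\<^sup>2 \<le> (ip_norm ip e)\<^sup>2 * (\<Sum>k\<in>{m..<n}. (norm (c k))\<^sup>2)" for m n
  proof (induction n)
    case (Suc n)
    show ?case
    proof (cases "m \<le> n")
      case True
      have "(ip_norm ip (\<Sum>k\<in>{m..<Suc n}. f k))\<^sup>2 = (ip_norm ip (\<Sum>k\<in>{m..<n}. f k))\<^sup>2 + (ip_norm ip (f n))\<^sup>2"
        using True by (simp add: ip_norm_add_sq fH sumH orth_sum)
      then show ?thesis using Suc f_norm[of n] True by (simp add: algebra_simps)
    qed (simp add: ip_norm_zero)
  qed (simp add: ip_norm_zero)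
  have "\<exists>F\<in>H. (\<lambda>n. ip_norm ip ((\<Sum>k<n. f k) - F)) \<longlonglongrightarrow> 0"
  proof (rule complete_carrier[OF sumH], intro allI impI)
    fix \<epsilon> :: real assume \<epsilon>: "\<epsilon> > 0"
    let ?K = "1 + (ip_norm ip e)\<^sup>2"
    have K: "?K > 0" by (simp add: add_pos_nonneg)
    have "\<epsilon>\<^sup>2 / ?K > 0" using \<epsilon> K by simp
    then obtain N where N: "\<And>m n. m \<ge> N \<Longrightarrow> norm (\<Sum>k\<in>{m..<n}. (norm (c k))\<^sup>2) < \<epsilon>\<^sup>2 / ?K"
      using c unfolding summable_Cauchy by blast
    have main: "ip_norm ip ((\<Sum>k<n. f k) - (\<Sum>k<m. f k)) < \<epsilon>" if "N \<le> m" "m \<le> n" for m n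
    proof -
      have "(\<Sum>k<n. f k) - (\<Sum>k<m. f k) = (\<Sum>k\<in>{m..<n}. f k)"
        using that sum_diff_nat_ivl[of 0 m n f] by (simp add: lessThan_atLeast0)
      moreover have "(ip_norm ip (\<Sum>k\<in>{m..<n}. f k))\<^sup>2 < \<epsilon>\<^sup>2"
      proof -
        have "(ip_norm ip (\<Sum>k\<in>{m..<n}. f k))\<^sup>2 \<le> ?K * (\<Sum>k\<in>{m..<n}. (norm (c k))\<^sup>2)"
          using pyth[of m n] sum_nonneg[of "{m..<n}" "\<lambda>k. (norm (c k))\<^sup>2"] by (simp add: algebra_simps)
        also have "\<dots> < ?K * (\<epsilon>\<^sup>2 / ?K)"
          using N[OF that(1), of n] K by (intro mult_strict_left_mono) auto
        finally show ?thesis using K by simp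
      qed
      ultimately show ?thesis using \<epsilon> by (simp add: power2_less_imp_less)
    qed
    have "ip_norm ip ((\<Sum>k<m. f k) - (\<Sum>k<n. f k)) < \<epsilon>" if "N \<le> m" "N \<le> n" for m n
    proof (cases "m \<le> n")
      case True
      then show ?thesis using main[of m n] that ip_norm_minus[OF sumH sumH] by metis
    next
      case False
      then show ?thesis using main[of n m] that by simp
    qed
    then show "\<exists>N. \<forall>m\<ge>N. \<forall>n\<ge>N. ip_norm ip ((\<Sum>k<m. f k) - (\<Sum>k<n. f k)) < \<epsilon>" by blast
  qed
  then show ?thesis by (simp add: f_def)
qed

text \<open>
  The tails of the series, pulled back by powers of \<open>T\<close>, again lie in \<open>H\<close>.  This algebraic
  recursion is all that survives of the convergence when the elements of \<open>H\<close> are functions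
  and point evaluations may be discontinuous.
\<close>

lemma near_isometry_wandering_series_tails:
  assumes T: "near_isometry_on smul H ip T" and e: "e \<in> H"
    and wandering: "\<And>x. x \<in> H \<Longrightarrow> ip (T x) e = 0"
    and c: "summable (\<lambda>k. (norm (c k))\<^sup>2)"
  obtains G where "\<And>m. G m \<in> H" "\<And>m::nat. G m = smul (c m) e + T (G (Suc m))"
proof -
  have bT: "bounded_operator_on smul H ip T" using T by (simp add: near_isometry_on_def)
  note TD = bounded_operator_onD[OF bT]
  from T have upper: "\<And>x. x \<in> H \<Longrightarrow> ip_norm ip (T x) \<le> ip_norm ip x"
    by (auto simp: near_isometry_on_def)
  define S where "S m n = (\<Sum>k<n. smul (c (k + m)) ((T ^^ k) e))" for m n
  have SH: "S m n \<in> H" for m n unfolding S_def by (intro sum_carrier scale_carrier TD(5) e)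
  have "\<exists>F. F \<in> H \<and> (\<lambda>n. ip_norm ip (S m n - F)) \<longlonglongrightarrow> 0" for m
    using near_isometry_wandering_series_converges[OF T e wandering, of "\<lambda>k. c (k + m)"]
      summable_ignore_initial_segment[OF c, of m] unfolding S_def by blast
  then have "\<exists>G. \<forall>m. G m \<in> H \<and> (\<lambda>n. ip_norm ip (S m n - G m)) \<longlonglongrightarrow> 0"
    by (intro choice allI)
  then obtain G where G: "\<And>m. G m \<in> H" "\<And>m. (\<lambda>n. ip_norm ip (S m n - G m)) \<longlonglongrightarrow> 0" by blast
  have step: "S m (Suc n) = smul (c m) e + T (S (Suc m) n)" for m n
  proof -
    have "T (\<Sum>k<n. smul (d k) ((T ^^ k) e)) = (\<Sum>k<n. smul (d k) ((T ^^ Suc k) e))" for d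
    proof (induction n)
      case 0
      show ?case using TD(4)[of 0 0] zero_carrier by simp
    next
      case (Suc n)
      have "(\<Sum>k<n. smul (d k) ((T ^^ k) e)) \<in> H" by (intro sum_carrier scale_carrier TD(5) e)
      then show ?case using Suc TD(5)[OF e, of n] by (simp add: TD carrier_closed)
    qed
    then show ?thesis unfolding S_def sum.lessThan_Suc_shift by simp
  qed
  have "G m = smul (c m) e + T (G (Suc m))" for m
  proof (rule limit_unique)
    show "S m (Suc n) \<in> H" for n using SH .
    show "(\<lambda>n. ip_norm ip (S m (Suc n) - G m)) \<longlonglongrightarrow> 0" using LIMSEQ_Suc[OF G(2)] .
    show "(\<lambda>n. ip_norm ip (S m (Suc n) - (smul (c m) e + T (G (Suc m))))) \<longlonglongrightarrow> 0"
    proof (rule tendsto_sandwich[OF _ _ tendsto_const G(2)[of "Suc m"]])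
      have eq: "S m (Suc n) - (smul (c m) e + T (G (Suc m))) = T (S (Suc m) n - G (Suc m))" for n
        using TD(4)[OF SH G(1), of "Suc m" n "Suc m"] by (simp add: step)
      have mem: "S (Suc m) n - G (Suc m) \<in> H" for n using SH G(1) by (simp add: carrier_closed)
      show "\<forall>\<^sub>F n in sequentially. 0 \<le> ip_norm ip (S m (Suc n) - (smul (c m) e + T (G (Suc m))))"
        unfolding eq using mem TD(1) by (simp add: ip_norm_nonneg)
      show "\<forall>\<^sub>F n in sequentially. ip_norm ip (S m (Suc n) - (smul (c m) e + T (G (Suc m))))
          \<le> ip_norm ip (S (Suc m) n - G (Suc m))"
        unfolding eq using mem upper by simp
    qed
  qed (use G(1) e TD(1) in \<open>auto simp: carrier_closed\<close>)
  then show thesis using that G(1) by blast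
qed

end

section \<open>Uniform boundedness of point evaluations on square-summable power series\<close>

text \<open>
  The Taylor coefficients of the normalized reproducing kernel at \<open>a\<close> of the Hardy space
  \<open>H\<^sup>2\<close> of the disc, which is identified with the square-summable sequences.
\<close>

definition hardy_kernel :: "complex \<Rightarrow> nat \<Rightarrow> complex" where
  "hardy_kernel a k = of_real (sqrt (1 - (norm a)\<^sup>2)) * cnj a ^ k"

lemma one_minus_norm_sq_pos: "norm (a::complex) < 1 \<Longrightarrow> 0 < 1 - (norm a)\<^sup>2"
  by (simp add: power_less_one_iff abs_square_less_1)

lemma hardy_kernel_eval:
  assumes a: "norm a < 1" and b: "norm b < 1"
  shows "(\<lambda>k. hardy_kernel b k * a ^ k) sums (of_real (sqrt (1 - (norm b)\<^sup>2)) / (1 - cnj b * a))"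
proof -
  have "norm (cnj b * a) < 1"
    using mult_strict_mono[OF a b] by (simp add: norm_mult mult.commute)
  from sums_mult[OF geometric_sums[OF this], of "of_real (sqrt (1 - (norm b)\<^sup>2))"]
  show ?thesis by (simp add: hardy_kernel_def power_mult_distrib mult_ac)
qed

lemma hardy_kernel_eval_self:
  assumes a: "norm a < 1"
  shows "(\<Sum>k. hardy_kernel a k * a ^ k) = of_real (1 / sqrt (1 - (norm a)\<^sup>2))"
proof -
  let ?s = "sqrt (1 - (norm a)\<^sup>2)"
  have s: "?s > 0" "?s * ?s = 1 - (norm a)\<^sup>2" using one_minus_norm_sq_pos[OF a] by auto
  have "1 - cnj a * a = of_real (?s * ?s)"
    using complex_norm_square[of a] s(2) by (simp add: mult.commute)
  then have "(\<Sum>k. hardy_kernel a k * a ^ k) = of_real (?s / (?s * ?s))"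
    using sums_unique[OF hardy_kernel_eval[OF a a]] by (simp only: of_real_divide)
  moreover have "?s / (?s * ?s) = 1 / ?s" using s(1) by (simp del: real_sqrt_mult_self)
  ultimately show ?thesis by (simp only:)
qed

text \<open>
  This is the Cauchy--Schwarz inequality for two normalized reproducing kernels; it comes down to
  \<open>\<bar>1 - cnj b * a\<bar>\<^sup>2 - (1 - \<bar>a\<bar>\<^sup>2) * (1 - \<bar>b\<bar>\<^sup>2) = \<bar>a - b\<bar>\<^sup>2\<close>.
\<close>

lemma norm_hardy_kernel_eval_le:
  assumes a: "norm a < 1" and b: "norm b < 1"
  shows "norm (\<Sum>k. hardy_kernel b k * a ^ k) \<le> 1 / sqrt (1 - (norm a)\<^sup>2)"
proof -
  have "(1 - (norm a)\<^sup>2) * (1 - (norm b)\<^sup>2) + (norm (a - b))\<^sup>2 = (norm (1 - cnj b * a))\<^sup>2"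
    unfolding cmod_power2 by (simp add: power2_eq_square algebra_simps)
  then have le: "(1 - (norm a)\<^sup>2) * (1 - (norm b)\<^sup>2) \<le> (norm (1 - cnj b * a))\<^sup>2"
    using zero_le_power2[of "norm (a - b)"] by linarith
  have "sqrt (1 - (norm a)\<^sup>2) * sqrt (1 - (norm b)\<^sup>2) \<le> norm (1 - cnj b * a)"
    using real_sqrt_le_mono[OF le] by (simp add: real_sqrt_mult)
  moreover have pos: "0 < sqrt (1 - (norm a)\<^sup>2)" "0 < sqrt (1 - (norm b)\<^sup>2)"
    using one_minus_norm_sq_pos a b by auto
  moreover have "0 < norm (1 - cnj b * a)"
    using calculation mult_pos_pos[OF pos] by linarith
  moreover have "norm (\<Sum>k. hardy_kernel b k * a ^ k) = sqrt (1 - (norm b)\<^sup>2) / norm (1 - cnj b * a)"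
    using one_minus_norm_sq_pos[OF b]
    by (subst sums_unique[OF hardy_kernel_eval[OF a b], symmetric]) (simp add: norm_divide)
  ultimately show ?thesis
    by (simp only: divide_le_eq le_divide_eq mult.commute times_divide_eq_right) (simp add: mult.commute)
qed

lemma norm_hardy_kernel_le_1: "norm a < 1 \<Longrightarrow> norm (hardy_kernel a k) \<le> 1"
  using one_minus_norm_sq_pos[of a]
  by (simp add: hardy_kernel_def norm_mult norm_power mult_le_one power_le_one)

lemma hardy_kernel_L2:
  assumes a: "norm a < 1"
  shows "L2_set (\<lambda>k. norm (hardy_kernel a k)) {..<K} \<le> 1"
proof -
  let ?x = "(norm a)\<^sup>2"
  have x: "0 < 1 - ?x" using one_minus_norm_sq_pos[OF a] .
  have "(\<Sum>k<K. (norm (hardy_kernel a k))\<^sup>2) = (\<Sum>k<K. (1 - ?x) * ?x ^ k)"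
    using x by (intro sum.cong) (auto simp: hardy_kernel_def norm_mult norm_power power_mult_distrib power_mult[symmetric] mult.commute)
  also have "\<dots> = 1 - ?x ^ K"
    using one_diff_power_eq[of ?x K] by (simp add: sum_distrib_left)
  finally show ?thesis by (simp add: L2_set_def)
qed

lemma summable_power_bounded_coeffs:
  fixes a :: complex
  assumes "norm a < 1" "\<And>k. norm (x k) \<le> K"
  shows "summable (\<lambda>k. x k * a ^ k)" and "norm (\<Sum>k. x k * a ^ k) \<le> K / (1 - norm a)"
proof -
  have g: "(\<lambda>k. K * norm a ^ k) sums (K * (1 / (1 - norm a)))"
    using assms(1) by (intro sums_mult geometric_sums) simp
  have le: "norm (x k * a ^ k) \<le> K * norm a ^ k" for k
    using assms(2) by (simp add: norm_mult norm_power mult_right_mono)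
  show "summable (\<lambda>k. x k * a ^ k)"
    using summable_comparison_test[of "\<lambda>k. x k * a ^ k" "\<lambda>k. K * norm a ^ k"] le sums_summable[OF g] by blast
  have "norm (\<Sum>k. x k * a ^ k) \<le> (\<Sum>k. K * norm a ^ k)"
    by (rule norm_suminf_le[OF le sums_summable[OF g]])
  then show "norm (\<Sum>k. x k * a ^ k) \<le> K / (1 - norm a)" using sums_unique[OF g] by simp
qed

text \<open>
  The uniform boundedness principle on the square-summable sequences, for the multiples
  \<open>A z\<close> of evaluation at \<open>W z\<close>; the norm of this evaluation is \<open>1 / sqrt (1 - \<bar>W z\<bar>\<^sup>2)\<close>.
  Were the norms unbounded, one could add up signed normalized kernels at points \<open>W (z j)\<close> with
  weights \<open>(1/3)^j\<close>: the sign makes the \<open>j\<close>-th step large at \<open>W (z j)\<close>, and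
  all later steps together undo at most half of it.
\<close>

proposition evaluations_uniformly_bounded:
  fixes A :: "'z \<Rightarrow> real" and W :: "'z \<Rightarrow> complex"
  assumes W: "\<And>z. z \<in> Z \<Longrightarrow> norm (W z) < 1"
    and bdd: "\<And>c. summable (\<lambda>k. (norm (c k))\<^sup>2) \<Longrightarrow> \<exists>K. \<forall>z\<in>Z. A z * norm (\<Sum>k. c k * W z ^ k) \<le> K"
  obtains C where "\<And>z. z \<in> Z \<Longrightarrow> A z \<le> C * sqrt (1 - (norm (W z))\<^sup>2)"
proof (rule ccontr)
  assume "\<not> thesis"
  then have "\<exists>z\<in>Z. 4 ^ j * sqrt (1 - (norm (W z))\<^sup>2) < A z" for j :: nat
    using that[of "4 ^ j"] by (meson not_le)
  then have "\<exists>z. \<forall>j. z j \<in> Z \<and> 4 ^ j * sqrt (1 - (norm (W (z j)))\<^sup>2) < A (z j)"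
    by (intro choice allI) blast
  then obtain z where zZ: "\<And>j::nat. z j \<in> Z"
    and big: "\<And>j. 4 ^ j * sqrt (1 - (norm (W (z j)))\<^sup>2) < A (z j)" by blast
  define a where "a j = W (z j)" for j
  have a: "norm (a j) < 1" for j using W zZ by (simp add: a_def)
  define N where "N w = 1 / sqrt (1 - (norm w)\<^sup>2)" for w :: complex
  have N: "N (a j) > 0" for j using one_minus_norm_sq_pos[OF a] by (simp add: N_def)
  define ev where "ev x w = (\<Sum>k. x k * w ^ k)" for x and w :: complex
  \<comment> \<open>the sign for which the value at \<open>a j\<close> is at least as large as that of the added kernel\<close>
  define sg where "sg x j = (if (1/3) ^ j * N (a j) \<le> norm (ev x (a j) + (1/3) ^ j * N (a j))
      then 1 else - 1 :: complex)" for x j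
  define x where "x = rec_nat (\<lambda>k. 0) (\<lambda>j x k. x k + (sg x j * (1/3) ^ j) * hardy_kernel (a j) k)"
  define s where "s j = sg (x j) j * (1/3) ^ j" for j
  have x0: "x 0 k = 0" and xS: "x (Suc j) k = x j k + s j * hardy_kernel (a j) k" for j k
    by (simp_all add: x_def s_def)
  have s: "norm (s j) = (1/3) ^ j" for j
    by (simp add: s_def sg_def norm_mult norm_power)
  have x_sum: "x j k = (\<Sum>i<j. s i * hardy_kernel (a i) k)" for j k
    by (induction j) (simp_all add: x0 xS)
  have term_le: "norm (s i * hardy_kernel (a i) k) \<le> (1/3) ^ i" for i k
    using mult_left_mono[OF norm_hardy_kernel_le_1[OF a, of i k], of "(1/3) ^ i"] by (simp add: norm_mult s)
  have geo: "(\<lambda>i. (1/3::real) ^ i) sums (3/2)" using geometric_sums[of "1/3::real"] by simp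
  have summ: "summable (\<lambda>i. s i * hardy_kernel (a i) k)" for k
    using summable_comparison_test[of "\<lambda>i. s i * hardy_kernel (a i) k" "\<lambda>i. (1/3) ^ i"] term_le
      sums_summable[OF geo] by blast
  define y where "y k = (\<Sum>i. s i * hardy_kernel (a i) k)" for k
  have y_diff: "norm (y k - x m k) \<le> (1/3) ^ m * (3/2)" for k m
  proof -
    have "y k - x m k = (\<Sum>i. s (i + m) * hardy_kernel (a (i + m)) k)"
      using suminf_split_initial_segment[OF summ, of k m] by (simp add: y_def x_sum)
    also have "norm \<dots> \<le> (\<Sum>i. (1/3) ^ m * (1/3) ^ i)"
    proof (rule norm_suminf_le)
      show "summable (\<lambda>i. (1/3::real) ^ m * (1/3) ^ i)" using sums_summable[OF geo] by (rule summable_mult)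
      show "norm (s (i + m) * hardy_kernel (a (i + m)) k) \<le> (1/3) ^ m * (1/3) ^ i" for i
        using term_le[of "i + m" k] by (simp add: power_add mult.commute)
    qed
    also have "\<dots> = (1/3) ^ m * (3/2)" using sums_unique[OF sums_mult[OF geo, of "(1/3) ^ m"]] by simp
    finally show ?thesis .
  qed
  have x_bd: "norm (x m k) \<le> 3/2" for m k
  proof -
    have "norm (x m k) \<le> (\<Sum>i<m. (1/3) ^ i)"
      unfolding x_sum by (rule sum_norm_le) (rule term_le)
    also have "\<dots> \<le> 3/2"
      using sum_le_suminf[OF sums_summable[OF geo], of "{..<m}"] sums_unique[OF geo] by simp
    finally show ?thesis .
  qed
  have y_bd: "norm (y k) \<le> 3/2" for k using y_diff[of k 0] by (simp add: x0)

  have y_summable: "summable (\<lambda>k. (norm (y k))\<^sup>2)"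
  proof (rule summableI_nonneg_bounded)
    fix K
    have L2_x: "L2_set (\<lambda>k. norm (x m k)) {..<K} \<le> (\<Sum>i<m. (1/3) ^ i)" for m
    proof (induction m)
      case (Suc m)
      have "L2_set (\<lambda>k. norm (x (Suc m) k)) {..<K}
          \<le> L2_set (\<lambda>k. norm (x m k) + (1/3) ^ m * norm (hardy_kernel (a m) k)) {..<K}"
        by (rule L2_set_mono) (auto simp: xS norm_mult s intro: order_trans[OF norm_triangle_ineq])
      also have "\<dots> \<le> L2_set (\<lambda>k. norm (x m k)) {..<K}
          + L2_set (\<lambda>k. (1/3) ^ m * norm (hardy_kernel (a m) k)) {..<K}"
        by (rule L2_set_triangle_ineq)
      also have "L2_set (\<lambda>k. (1/3) ^ m * norm (hardy_kernel (a m) k)) {..<K}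
          = (1/3) ^ m * L2_set (\<lambda>k. norm (hardy_kernel (a m) k)) {..<K}"
        by (rule L2_set_right_distrib[symmetric]) simp
      also have "\<dots> \<le> (1/3) ^ m"
        using mult_left_mono[OF hardy_kernel_L2[OF a, of m K], of "(1/3) ^ m"] by simp
      finally show ?case using Suc by simp
    qed (simp add: x0 L2_set_def)
    have "(\<Sum>k<K. (norm (x m k))\<^sup>2) \<le> (3/2)\<^sup>2" for m
    proof -
      have "L2_set (\<lambda>k. norm (x m k)) {..<K} \<le> 3/2"
        using L2_x[of m] sum_le_suminf[OF sums_summable[OF geo], of "{..<m}"] sums_unique[OF geo] by simp
      then have "(L2_set (\<lambda>k. norm (x m k)) {..<K})\<^sup>2 \<le> (3/2)\<^sup>2" by (intro power_mono) auto
      then show ?thesis by (simp add: L2_set_def sum_nonneg)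
    qed
    moreover have "(\<lambda>m. \<Sum>k<K. (norm (x m k))\<^sup>2) \<longlonglongrightarrow> (\<Sum>k<K. (norm (y k))\<^sup>2)"
    proof (intro tendsto_intros)
      show "(\<lambda>m. x m k) \<longlonglongrightarrow> y k" for k
        unfolding x_sum y_def using summable_LIMSEQ[OF summ] .
    qed
    ultimately show "(\<Sum>k<K. (norm (y k))\<^sup>2) \<le> (3/2)\<^sup>2"
      using tendsto_upperbound[of _ "\<Sum>k<K. (norm (y k))\<^sup>2" sequentially "(3/2)\<^sup>2"] by simp
  qed simp

  have ev_step: "ev (x (Suc j)) w = ev (x j) w + s j * ev (hardy_kernel (a j)) w" if w: "norm w < 1" for j w
  proof -
    note sum1 = summable_power_bounded_coeffs(1)[OF w x_bd[of j]]
      and sum2 = summable_power_bounded_coeffs(1)[OF w norm_hardy_kernel_le_1[OF a[of j]]]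
    have "ev (x (Suc j)) w = (\<Sum>k. x j k * w ^ k + s j * (hardy_kernel (a j) k * w ^ k))"
      unfolding ev_def xS by (simp add: algebra_simps)
    also have "\<dots> = ev (x j) w + s j * ev (hardy_kernel (a j)) w"
      unfolding ev_def using suminf_add[OF sum1 summable_mult[OF sum2, of "s j"]] suminf_mult[OF sum2, of "s j"] by simp
    finally show ?thesis .
  qed
  have ev_large: "(1/3) ^ j * N (a j) \<le> norm (ev (x (Suc j)) (a j))" for j
  proof -
    let ?p = "ev (x j) (a j)" and ?q = "(1/3) ^ j * N (a j)"
    have eq: "ev (x (Suc j)) (a j) = ?p + sg (x j) j * of_real ?q"
      using ev_step[OF a] hardy_kernel_eval_self[OF a, of j] by (simp add: s_def ev_def N_def mult_ac)
    show ?thesis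
    proof (cases "?q \<le> norm (?p + of_real ?q)")
      case True
      then show ?thesis unfolding eq by (simp add: sg_def)
    next
      case False
      then have "ev (x (Suc j)) (a j) = ?p - of_real ?q" unfolding eq by (simp add: sg_def)
      moreover have "norm (2 * complex_of_real ?q) \<le> norm (?p + of_real ?q) + norm (?p - of_real ?q)"
        using norm_triangle_ineq4[of "?p + of_real ?q" "?p - of_real ?q"] by (simp add: norm_mult mult.commute)
      moreover have "norm (2 * complex_of_real ?q) = 2 * ?q"
        using N[of j] by (simp add: norm_mult norm_power norm_divide)
      ultimately show ?thesis using False by simp
    qed
  qed
  have ev_tail: "norm (ev (x (Suc j + n)) (a j) - ev (x (Suc j)) (a j)) \<le> N (a j) * (1/3) ^ j / 2 * (1 - (1/3) ^ n)" for j n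
  proof (induction n)
    case (Suc n)
    let ?i = "Suc j + n"
    have "ev (x (Suc ?i)) (a j) - ev (x (Suc j)) (a j)
        = (ev (x ?i) (a j) - ev (x (Suc j)) (a j)) + s ?i * ev (hardy_kernel (a ?i)) (a j)"
      using ev_step[OF a, of ?i j] by simp
    also have "norm \<dots> \<le> norm (ev (x ?i) (a j) - ev (x (Suc j)) (a j)) + norm (s ?i * ev (hardy_kernel (a ?i)) (a j))"
      by (rule norm_triangle_ineq)
    also have "\<dots> \<le> N (a j) * (1/3) ^ j / 2 * (1 - (1/3) ^ n) + (1/3) ^ ?i * N (a j)"
      using Suc norm_hardy_kernel_eval_le[OF a a, of ?i j]
      unfolding norm_mult s by (intro add_mono mult_left_mono) (auto simp: ev_def N_def)
    also have "\<dots> = N (a j) * (1/3) ^ j / 2 * (1 - (1/3) ^ Suc n)"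
      by (simp add: power_add field_simps)
    finally show ?case by simp
  qed simp
  have ev_lim: "(\<lambda>m. ev (x m) (a j)) \<longlonglongrightarrow> ev y (a j)" for j
  proof (rule metric_LIMSEQ_I)
    have bound: "norm (ev (x m) (a j) - ev y (a j)) \<le> (1/3) ^ m * (3/2) / (1 - norm (a j))" for m
    proof -
      have "ev y (a j) - ev (x m) (a j) = (\<Sum>k. (y k - x m k) * a j ^ k)"
        unfolding ev_def
        using suminf_diff[OF summable_power_bounded_coeffs(1)[OF a[of j] y_bd] summable_power_bounded_coeffs(1)[OF a[of j] x_bd[of m]]]
        by (simp add: left_diff_distrib)
      also have "norm \<dots> \<le> (1/3) ^ m * (3/2) / (1 - norm (a j))"
        by (rule summable_power_bounded_coeffs(2)[OF a y_diff])
      finally show ?thesis by (subst norm_minus_commute)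
    qed
    fix r :: real assume "r > 0"
    have "(\<lambda>m. (1/3) ^ m * (3/2) / (1 - norm (a j))) \<longlonglongrightarrow> 0 * (3/2) / (1 - norm (a j))"
      using a[of j] by (intro tendsto_intros LIMSEQ_realpow_zero) auto
    then have "\<forall>\<^sub>F m in sequentially. (1/3) ^ m * (3/2) / (1 - norm (a j)) < r"
      using order_tendstoD(2)[of _ "0 * (3/2) / (1 - norm (a j))" sequentially r] \<open>r > 0\<close> by simp
    then obtain M where "\<And>m. m \<ge> M \<Longrightarrow> (1/3) ^ m * (3/2) / (1 - norm (a j)) < r"
      unfolding eventually_sequentially by blast
    then show "\<exists>no. \<forall>n\<ge>no. dist (ev (x n) (a j)) (ev y (a j)) < r"
      unfolding dist_norm using bound le_less_trans by blast
  qed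
  have ev_y: "N (a j) * (1/3) ^ j / 2 \<le> norm (ev y (a j))" for j
  proof (rule tendsto_lowerbound)
    show "(\<lambda>n. norm (ev (x (Suc j + n)) (a j))) \<longlonglongrightarrow> norm (ev y (a j))"
      using LIMSEQ_ignore_initial_segment[OF tendsto_norm[OF ev_lim], of "Suc j"] by (simp add: add.commute)
    show "\<forall>\<^sub>F n in sequentially. N (a j) * (1/3) ^ j / 2 \<le> norm (ev (x (Suc j + n)) (a j))"
    proof (intro always_eventually allI)
      fix n
      have "N (a j) * (1/3) ^ j / 2 * (1 - (1/3) ^ n) \<le> N (a j) * (1/3) ^ j / 2"
        using N[of j] by (intro mult_right_le_one_le) (auto simp: power_le_one)
      then show "N (a j) * (1/3) ^ j / 2 \<le> norm (ev (x (Suc j + n)) (a j))"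
        using ev_large[of j] ev_tail[of j n]
          norm_triangle_ineq2[of "ev (x (Suc j)) (a j)" "ev (x (Suc j)) (a j) - ev (x (Suc j + n)) (a j)"]
          norm_minus_commute[of "ev (x (Suc j)) (a j)" "ev (x (Suc j + n)) (a j)"]
        by (simp add: mult_ac)
    qed
  qed simp
  obtain K where K: "\<And>z. z \<in> Z \<Longrightarrow> A z * norm (ev y (W z)) \<le> K"
    using bdd[OF y_summable] unfolding ev_def by blast
  \<comment> \<open>the growth \<open>4 ^ j\<close> of the norms beats the weights \<open>(1/3) ^ j\<close>\<close>
  have "(4/3) ^ j / 2 \<le> K" for j :: nat
  proof -
    have "(4/3) ^ j / 2 = (4 ^ j / N (a j)) * (N (a j) * (1/3) ^ j / 2)"
      using N[of j] by (simp add: power_divide)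
    also have "\<dots> \<le> A (z j) * norm (ev y (a j))"
      using big[of j] ev_y[of j] N[of j]
      by (intro mult_mono) (auto simp: N_def a_def intro: order_trans[rotated] less_imp_le)
    also have "\<dots> \<le> K" using K[OF zZ] by (simp add: a_def)
    finally show ?thesis .
  qed
  moreover obtain j :: nat where "2 * K < (4/3) ^ j" using real_arch_pow[of "4/3"] by auto
  ultimately show False by (metis divide_right_mono less_divide_eq_numeral1(1) mult.commute not_le zero_le_numeral)
qed

section \<open>Holomorphic functions on the disc\<close>

text \<open>
  Cauchy's formula for \<open>z \<mapsto> h z * (r\<^sup>2 - \<bar>w\<bar>\<^sup>2) / (r\<^sup>2 - cnj w * z)\<close>, which takes the value
  \<open>h w\<close> at \<open>w\<close>; on the circle \<open>\<bar>z\<bar> = r\<close> the extra factor turns the Cauchy kernel into the positive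
  Poisson kernel.
\<close>

lemma Poisson_formula_holomorphic:
  assumes h: "h holomorphic_on ball 0 1" and r: "0 < r" "r < 1" and w: "norm w < r"
  shows "((\<lambda>t. h (of_real r * cis t) * of_real ((r\<^sup>2 - (norm w)\<^sup>2) / (norm (of_real r * cis t - w))\<^sup>2))
           has_integral (2 * of_real pi * h w)) {0..2 * pi}"
proof -
  define H where "H z = h z * (of_real (r\<^sup>2 - (norm w)\<^sup>2) / (of_real (r\<^sup>2) - cnj w * z))" for z
  have sub: "cball 0 r \<subseteq> ball (0::complex) 1" using r by auto
  have nz: "of_real (r\<^sup>2) - cnj w * z \<noteq> 0" if "norm z \<le> r" for z
  proof
    assume "of_real (r\<^sup>2) - cnj w * z = 0"
    then have "r\<^sup>2 = norm (cnj w * z)" using r by (metis abs_of_nonneg eq_iff_diff_eq_0 norm_of_real zero_le_power2)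
    also have "\<dots> \<le> norm w * r" using that by (simp add: norm_mult mult_left_mono)
    also have "\<dots> < r * r" using w r by simp
    finally show False by (simp add: power2_eq_square)
  qed
  have "H holomorphic_on cball 0 r"
    unfolding H_def using nz holomorphic_on_subset[OF h sub] by (intro holomorphic_intros) auto
  from Cauchy_integral_circlepath_simple[OF this, of w]
  have "((\<lambda>u. H u / (u - w)) has_contour_integral 2 * of_real pi * \<i> * H w) (circlepath 0 r)"
    using w by simp
  then have int: "((\<lambda>t. H (of_real r * cis t) / (of_real r * cis t - w) * of_real r * \<i> * cis t)
      has_integral 2 * of_real pi * \<i> * H w) {0..2 * pi}"
    by (simp add: circlepath_def has_contour_integral_part_circlepath_iff)
  have "of_real (r\<^sup>2) - cnj w * w = of_real (r\<^sup>2 - (norm w)\<^sup>2)"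
    using complex_norm_square[of w] by (simp add: mult.commute)
  then have Hw: "H w = h w" using nz[of w] w by (simp add: H_def)
  have eq: "H (of_real r * cis t) / (of_real r * cis t - w) * of_real r * \<i> * cis t
      = \<i> * (h (of_real r * cis t) * of_real ((r\<^sup>2 - (norm w)\<^sup>2) / (norm (of_real r * cis t - w))\<^sup>2))" for t
  proof -
    let ?z = "of_real r * cis t"
    have z: "norm ?z = r" using r by (simp add: norm_mult)
    then have zw: "?z - w \<noteq> 0" and z0: "?z \<noteq> 0" using w r by auto
    have zz: "of_real (r\<^sup>2) = ?z * cnj ?z" using complex_norm_square[of ?z] z by simp
    have "of_real (r\<^sup>2) - cnj w * ?z = ?z * cnj (?z - w)" unfolding zz by (simp add: algebra_simps)
    then have "H ?z / (?z - w) * (?z * \<i>)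
        = h ?z * of_real (r\<^sup>2 - (norm w)\<^sup>2) / (?z * cnj (?z - w)) / (?z - w) * (?z * \<i>)"
      by (simp only: H_def times_divide_eq_right)
    also have "\<dots> = \<i> * (h ?z * of_real (r\<^sup>2 - (norm w)\<^sup>2) / ((?z - w) * cnj (?z - w)))"
    proof -
      have "X / (u * c) / d * (u * \<i>) = \<i> * (X / (d * c))" if "u \<noteq> 0" for X u c d :: complex
        using that by (cases "c = 0"; cases "d = 0") (auto simp: field_simps)
      then show ?thesis using z0 by blast
    qed
    also have "(?z - w) * cnj (?z - w) = of_real ((norm (?z - w))\<^sup>2)"
      using complex_norm_square[of "?z - w"] by simp
    finally show ?thesis by (simp add: mult_ac)
  qed
  have "((\<lambda>t. \<i> * (h (of_real r * cis t) * of_real ((r\<^sup>2 - (norm w)\<^sup>2) / (norm (of_real r * cis t - w))\<^sup>2)))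
      has_integral \<i> * (2 * of_real pi * h w)) {0..2 * pi}"
    using int unfolding eq Hw by (simp add: mult_ac)
  from has_integral_mult_right[OF this, of "- \<i>"] show ?thesis
    by (simp add: mult.assoc[symmetric] del: mult.assoc)
qed

text \<open>
  Jensen's inequality for the Poisson kernel, up to the factor \<open>2 powr p\<close>: it suffices to integrate
  \<open>x \<le> s + s powr (1 - p) * x powr p\<close> with \<open>s = \<bar>h w\<bar> / 2\<close>.  The Poisson kernel
  is at most \<open>2 / (r - \<bar>w\<bar>)\<close> since \<open>r < 1\<close>.
\<close>

lemma norm_powr_le_circle_mean:
  assumes h: "h holomorphic_on ball 0 1" and r: "0 < r" "r < 1" and w: "norm w < r" and p: "p \<ge> 1"
  shows "norm (h w) powr p
    \<le> 2 powr p / (pi * (r - norm w)) * integral {0..2 * pi} (\<lambda>t. norm (h (of_real r * cis t)) powr p)"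
proof -
  let ?z = "\<lambda>t. of_real r * cis t"
  have zr: "norm (?z t) = r" for t using r by (simp add: norm_mult)
  have hcont: "continuous_on {0..2 * pi} (\<lambda>t. h (?z t))"
    using r zr by (intro continuous_on_compose2[OF holomorphic_on_imp_continuous_on[OF h]])
      (auto intro!: continuous_intros simp: dist_norm)
  have hpcont: "continuous_on {0..2 * pi} (\<lambda>t. norm (h (?z t)) powr p)"
    using p by (intro continuous_on_powr' continuous_intros hcont) auto
  show ?thesis
  proof (cases "h w = 0")
    case True
    have "0 \<le> integral {0..2 * pi} (\<lambda>t. norm (h (?z t)) powr p)"
      by (intro Henstock_Kurzweil_Integration.integral_nonneg integrable_continuous_real hpcont) simp
    then show ?thesis using w True by simp
  next
    case False
    define s where "s = norm (h w) / 2"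
    have s: "s > 0" using False by (simp add: s_def)
    define P where "P t = (r\<^sup>2 - (norm w)\<^sup>2) / (norm (?z t - w))\<^sup>2" for t
    have dist: "r - norm w \<le> norm (?z t - w)" for t
      using norm_triangle_ineq2[of "?z t" w] zr by simp
    have pos: "0 < r - norm w" using w by simp
    have P0: "0 \<le> P t" for t using w by (simp add: P_def power_mono)
    have P_le: "P t \<le> 2 / (r - norm w)" for t
    proof -
      have "0 < norm (?z t - w)" using dist[of t] pos by linarith
      then have "P t \<le> (r\<^sup>2 - (norm w)\<^sup>2) / (r - norm w)\<^sup>2"
        unfolding P_def using dist[of t] pos w
        by (intro divide_left_mono power_mono mult_pos_pos zero_less_power) (auto simp: power_mono)
      also have "\<dots> = (r + norm w) / (r - norm w)"
      proof -
        have "r\<^sup>2 - (norm w)\<^sup>2 = (r + norm w) * (r - norm w)" by (simp add: power2_eq_square algebra_simps)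
        then show ?thesis using pos by (simp add: power2_eq_square)
      qed
      also have "\<dots> \<le> 2 / (r - norm w)"
        using w r pos by (intro divide_right_mono) auto
      finally show ?thesis .
    qed
    have Pcont: "continuous_on {0..2 * pi} P"
    proof -
      have "?z t - w \<noteq> 0" for t using dist[of t] pos by auto
      then show ?thesis unfolding P_def by (intro continuous_intros) auto
    qed
    define J where "J = integral {0..2 * pi} (\<lambda>t. norm (h (?z t)) powr p)"
    have intP: "(P has_integral 2 * pi) {0..2 * pi}"
    proof -
      have "((\<lambda>t. complex_of_real (P t)) has_integral (2 * of_real pi)) {0..2 * pi}"
        using Poisson_formula_holomorphic[of "\<lambda>_. 1" r w] r w by (simp add: P_def)
      from has_integral_linear[OF this bounded_linear_Re] show ?thesis by (simp add: o_def)
    qed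
    have "norm (2 * of_real pi * h w) \<le> integral {0..2 * pi} (\<lambda>t. P t * s + 2 / (r - norm w) * s powr (1 - p) * norm (h (?z t)) powr p)"
    proof -
      have int: "((\<lambda>t. h (?z t) * of_real (P t)) has_integral (2 * of_real pi * h w)) {0..2 * pi}"
        using Poisson_formula_holomorphic[OF h r w] by (simp add: P_def)
      have "norm (integral {0..2 * pi} (\<lambda>t. h (?z t) * of_real (P t)))
          \<le> integral {0..2 * pi} (\<lambda>t. P t * s + 2 / (r - norm w) * s powr (1 - p) * norm (h (?z t)) powr p)"
      proof (rule integral_norm_bound_integral)
        show "(\<lambda>t. h (?z t) * of_real (P t)) integrable_on {0..2 * pi}" using int by blast
        show "(\<lambda>t. P t * s + 2 / (r - norm w) * s powr (1 - p) * norm (h (?z t)) powr p) integrable_on {0..2 * pi}"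
          by (intro integrable_continuous_real continuous_intros Pcont hpcont)
        fix t
        have young: "x \<le> s + s powr (1 - p) * x powr p" if "x \<ge> 0" for x
        proof (cases "x \<le> s")
          case True
          then show ?thesis by (simp add: add_increasing2)
        next
          case False
          then have x: "s < x" "x > 0" using s by auto
          have "x = x powr (1 - p) * x powr p" using x by (simp add: powr_add[symmetric])
          also have "\<dots> \<le> s powr (1 - p) * x powr p"
            using x s p by (intro mult_right_mono powr_mono2') auto
          finally show ?thesis using s by simp
        qed
        have "norm (h (?z t) * of_real (P t)) = P t * norm (h (?z t))"
          using P0 by (simp add: norm_mult mult.commute)
        also have "\<dots> \<le> P t * (s + s powr (1 - p) * norm (h (?z t)) powr p)"
          using P0 young by (intro mult_left_mono) auto
        also have "\<dots> = P t * s + P t * (s powr (1 - p) * norm (h (?z t)) powr p)"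
          by (simp add: distrib_left)
        also have "\<dots> \<le> P t * s + 2 / (r - norm w) * (s powr (1 - p) * norm (h (?z t)) powr p)"
          by (intro add_left_mono mult_right_mono P_le) simp
        finally show "norm (h (?z t) * of_real (P t)) \<le> P t * s + 2 / (r - norm w) * s powr (1 - p) * norm (h (?z t)) powr p"
          by (simp add: mult.assoc)
      qed
      then show ?thesis using integral_unique[OF int] by simp
    qed
    also have "\<dots> = integral {0..2 * pi} (\<lambda>t. P t * s) + integral {0..2 * pi} (\<lambda>t. 2 / (r - norm w) * s powr (1 - p) * norm (h (?z t)) powr p)"
      by (intro integral_add integrable_continuous_real continuous_intros Pcont hpcont)
    also have "\<dots> = 2 * pi * s + 2 / (r - norm w) * s powr (1 - p) * J"
      using integral_unique[OF intP] by (simp add: J_def)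
    finally have "2 * pi * norm (h w) \<le> 2 * pi * s + 2 / (r - norm w) * s powr (1 - p) * J"
      by (simp add: norm_mult)
    then have "2 * pi * s \<le> 2 / (r - norm w) * s powr (1 - p) * J"
      by (simp add: s_def)
    then have "(2 * pi * s) * s powr (p - 1) \<le> (2 / (r - norm w) * s powr (1 - p) * J) * s powr (p - 1)"
      by (rule mult_right_mono) simp
    moreover have "s * s powr (p - 1) = s powr p" using s by (simp add: powr_mult_base)
    moreover have "s powr (1 - p) * s powr (p - 1) = 1" using s by (simp add: powr_add[symmetric])
    ultimately have "2 * pi * s powr p \<le> 2 / (r - norm w) * J"
      by (simp add: mult_ac) (metis (no_types, opaque_lifting) mult.assoc mult.commute mult.right_neutral)
    then have "s powr p \<le> J / (pi * (r - norm w))"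
      using pos by (simp add: field_simps)
    then have "2 powr p * s powr p \<le> 2 powr p * (J / (pi * (r - norm w)))"
      by (rule mult_left_mono) simp
    moreover have "2 powr p * s powr p = norm (h w) powr p"
      using s by (simp add: powr_mult[symmetric]) (simp add: s_def)
    ultimately show ?thesis by (simp add: J_def)
  qed
qed

lemma norm_powr_le_circle_nn_integral:
  assumes h: "h holomorphic_on ball 0 1" and r: "0 < r" "r < 1" and w: "norm w < r" and p: "p \<ge> 1"
  shows "ennreal (norm (h w) powr p) \<le> ennreal (2 powr p / (pi * (r - norm w)))
     * (\<integral>\<^sup>+t. ennreal (norm (h (of_real r * cis t)) powr p) * indicator {0..2 * pi} t \<partial>lborel)"
proof -
  let ?f = "\<lambda>t. norm (h (of_real r * cis t)) powr p"
  have "continuous_on UNIV (\<lambda>t. h (of_real r * cis t))"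
    using r by (intro continuous_on_compose2[OF holomorphic_on_imp_continuous_on[OF h]])
      (auto intro!: continuous_intros simp: dist_norm norm_mult)
  then have cont: "continuous_on UNIV ?f"
    using p by (intro continuous_on_powr' continuous_intros) auto
  have "(?f has_integral integral {0..2 * pi} ?f) {0..2 * pi}"
    by (intro integrable_integral integrable_continuous_real continuous_on_subset[OF cont]) auto
  from nn_integral_has_integral_lebesgue[OF _ this]
  have "(\<integral>\<^sup>+t. ennreal (indicator {0..2 * pi} t * ?f t) \<partial>lborel) = ennreal (integral {0..2 * pi} ?f)"
    using borel_measurable_continuous_onI[OF cont] by simp
  moreover have "(\<integral>\<^sup>+t. ennreal (?f t) * indicator {0..2 * pi} t \<partial>lborel)
      = (\<integral>\<^sup>+t. ennreal (indicator {0..2 * pi} t * ?f t) \<partial>lborel)"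
    by (intro nn_integral_cong) (simp add: indicator_def)
  ultimately have "(\<integral>\<^sup>+t. ennreal (?f t) * indicator {0..2 * pi} t \<partial>lborel) = ennreal (integral {0..2 * pi} ?f)"
    by simp
  moreover have "0 \<le> integral {0..2 * pi} ?f"
    by (intro Henstock_Kurzweil_Integration.integral_nonneg integrable_continuous_real continuous_on_subset[OF cont]) auto
  then have "ennreal (2 powr p / (pi * (r - norm w)) * integral {0..2 * pi} ?f)
      = ennreal (2 powr p / (pi * (r - norm w))) * ennreal (integral {0..2 * pi} ?f)"
    using w by (intro ennreal_mult) auto
  ultimately show ?thesis
    using ennreal_leI[OF norm_powr_le_circle_mean[OF assms]] by simp
qed

text \<open>
  A nonzero \<open>h\<close> would be \<open>(z - \<alpha>)^n * g\<close> near \<open>\<alpha>\<close> with \<open>g\<close> free of zeros, whereas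
  \<open>b^(n+1)\<close> is divisible by \<open>(z - \<alpha>)^(n+1)\<close>.
\<close>

lemma holomorphic_infinite_order_zero:
  assumes h: "h holomorphic_on ball 0 1" and b: "b holomorphic_on ball 0 1"
    and \<alpha>: "\<alpha> \<in> ball 0 1" "b \<alpha> = 0"
    and factor: "\<And>m::nat. \<exists>q. q holomorphic_on ball 0 1 \<and> (\<forall>z\<in>ball 0 1. h z = b z ^ m * q z)"
    and z: "z \<in> ball 0 1"
  shows "h z = 0"
proof (rule ccontr)
  assume hz: "h z \<noteq> 0"
  have h\<alpha>: "h \<alpha> = 0" using factor[of 1] \<alpha> by auto
  have "\<not> h constant_on ball 0 1" using hz h\<alpha> z \<alpha>(1) unfolding constant_on_def by metis
  from holomorphic_factor_zero_nonconstant[OF h open_ball convex_connected[OF convex_ball] \<alpha>(1) h\<alpha> this]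
  obtain g r n where r: "0 < r" "ball \<alpha> r \<subseteq> ball 0 1" and g: "g holomorphic_on ball \<alpha> r"
    and hg: "\<And>w. w \<in> ball \<alpha> r \<Longrightarrow> h w = (w - \<alpha>) ^ n * g w"
    and gnz: "\<And>w. w \<in> ball \<alpha> r \<Longrightarrow> g w \<noteq> 0" by metis
  have "\<exists>c. c holomorphic_on ball 0 1 \<and> (\<forall>w\<in>ball 0 1. b w = (w - \<alpha>) * c w)"
  proof -
    let ?c = "\<lambda>w. if w = \<alpha> then deriv b \<alpha> else (b w - b \<alpha>) / (w - \<alpha>)"
    have "?c holomorphic_on ball 0 1"
      using \<alpha> by (intro pole_lemma_open[OF b]) auto
    moreover have "\<forall>w\<in>ball 0 1. b w = (w - \<alpha>) * ?c w" using \<alpha> by auto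
    ultimately show ?thesis by blast
  qed
  then obtain c where c: "c holomorphic_on ball 0 1" "\<And>w. w \<in> ball 0 1 \<Longrightarrow> b w = (w - \<alpha>) * c w" by blast
  obtain q where q: "q holomorphic_on ball 0 1" "\<And>z. z \<in> ball 0 1 \<Longrightarrow> h z = b z ^ Suc n * q z"
    using factor[of "Suc n"] by blast
  let ?k = "\<lambda>w. (w - \<alpha>) * (c w ^ Suc n * q w)"
  have eq: "g w = ?k w" if w: "w \<in> ball \<alpha> r" "w \<noteq> \<alpha>" for w
  proof -
    have w1: "w \<in> ball 0 1" using w r by blast
    have "(w - \<alpha>) ^ n * g w = (w - \<alpha>) ^ n * ?k w"
      unfolding hg[OF w(1), symmetric] q(2)[OF w1] c(2)[OF w1]
      by (simp only: power_mult_distrib power_Suc mult_ac)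
    then show ?thesis using w by simp
  qed
  have \<alpha>r: "\<alpha> \<in> ball \<alpha> r" using r by simp
  have "isCont g \<alpha>"
    using holomorphic_on_imp_continuous_on[OF g] \<alpha>r by (simp add: continuous_on_eq_continuous_at)
  moreover have "isCont ?k \<alpha>"
  proof -
    have "continuous_on (ball 0 1) ?k"
      by (intro holomorphic_on_imp_continuous_on holomorphic_intros c q)
    then show ?thesis using \<alpha>(1) by (simp add: continuous_on_eq_continuous_at)
  qed
  moreover have "\<forall>\<^sub>F w in at \<alpha>. g w = ?k w"
    unfolding eventually_at using eq r(1) by (intro exI[of _ r]) (auto simp: dist_commute)
  ultimately have "g \<alpha> = ?k \<alpha>"
    using tendsto_unique[of "at \<alpha>" g "g \<alpha>" "?k \<alpha>"] filterlim_cong[OF refl refl, of g ?k "at \<alpha>"]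
    unfolding isCont_def by (metis trivial_limit_at)
  then show False using gnz[OF \<alpha>r] by simp
qed

text \<open>
  The maximum modulus principle on the discs of radius \<open>r\<close>, as \<open>r\<close> tends to 1.
\<close>

lemma holomorphic_zero_if_vanishing_at_boundary:
  assumes h: "h holomorphic_on ball 0 1" and \<epsilon>: "\<epsilon> > 0"
    and le: "\<And>z. z \<in> ball 0 1 \<Longrightarrow> norm (h z) \<le> C * (1 - norm z) powr \<epsilon>"
    and z: "z \<in> ball 0 1"
  shows "h z = 0"
proof -
  have bound: "norm (h z) \<le> C * (1 - r) powr \<epsilon>" if r: "norm z < r" "r < 1" for r
  proof (rule maximum_modulus_frontier[where f = h and S = "cball 0 r"])
    have r0: "r > 0" using r norm_ge_zero[of z] by linarith
    have sub: "cball 0 r \<subseteq> ball (0::complex) 1" using r by auto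
    show "h holomorphic_on interior (cball 0 r)"
      using h sub interior_subset by (blast intro: holomorphic_on_subset)
    show "continuous_on (closure (cball 0 r)) h"
      using holomorphic_on_imp_continuous_on[OF holomorphic_on_subset[OF h sub]] by simp
    show "norm (h w) \<le> C * (1 - r) powr \<epsilon>" if "w \<in> frontier (cball 0 r)" for w
      using that le[of w] r r0 by (simp add: frontier_cball)
  qed (use r in auto)
  have "((\<lambda>r. C * (1 - r) powr \<epsilon>) \<longlongrightarrow> C * (1 - 1) powr \<epsilon>) (at_left 1)"
  proof -
    have "continuous_on UNIV (\<lambda>r::real. \<bar>1 - r\<bar> powr \<epsilon>)"
      using \<epsilon> by (intro continuous_on_powr' continuous_intros) auto
    then have "isCont (\<lambda>r::real. \<bar>1 - r\<bar> powr \<epsilon>) 1"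
      by (simp add: continuous_on_eq_continuous_at)
    then have "((\<lambda>r::real. \<bar>1 - r\<bar> powr \<epsilon>) \<longlongrightarrow> \<bar>1 - 1\<bar> powr \<epsilon>) (at_left 1)"
      unfolding isCont_def filterlim_at_split by blast
    moreover have "\<forall>\<^sub>F r::real in at_left 1. \<bar>1 - r\<bar> powr \<epsilon> = (1 - r) powr \<epsilon>"
      by (auto simp: eventually_at_filter)
    ultimately have "((\<lambda>r::real. (1 - r) powr \<epsilon>) \<longlongrightarrow> \<bar>1 - 1\<bar> powr \<epsilon>) (at_left 1)"
      by (rule Lim_transform_eventually)
    from tendsto_mult_left[OF this, where c = C] show ?thesis by simp
  qed
  moreover have "\<forall>\<^sub>F r in at_left 1. norm (h z) \<le> C * (1 - r) powr \<epsilon>"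
    using bound z by (subst eventually_at_left[of "norm z"]) (auto intro: exI[of _ "norm z"])
  ultimately have "norm (h z) \<le> 0"
    using tendsto_lowerbound[of _ _ "at_left (1::real)"] \<epsilon> by (fastforce simp: trivial_limit_at_left_real)
  then show ?thesis by simp
qed

section \<open>Finite Blaschke products near the boundary\<close>

lemma Blaschke_factor_identity:
  assumes "norm a < 1" "norm z < 1"
  shows "1 - (norm ((z - a) / (1 - cnj a * z)))\<^sup>2 = (1 - (norm a)\<^sup>2) * (1 - (norm z)\<^sup>2) / (norm (1 - cnj a * z))\<^sup>2"
    and "1 - norm a \<le> norm (1 - cnj a * z)"
proof -
  have "norm (cnj a * z) \<le> norm a" using assms by (simp add: norm_mult mult_left_le)
  then show le: "1 - norm a \<le> norm (1 - cnj a * z)"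
    using norm_triangle_ineq2[of 1 "cnj a * z"] by simp
  then have nz: "norm (1 - cnj a * z) > 0" using assms by linarith
  have "(norm (1 - cnj a * z))\<^sup>2 - (norm (z - a))\<^sup>2 = (1 - (norm a)\<^sup>2) * (1 - (norm z)\<^sup>2)"
    unfolding cmod_power2 by (simp add: power2_eq_square algebra_simps)
  moreover have "1 - (norm ((z - a) / (1 - cnj a * z)))\<^sup>2
      = ((norm (1 - cnj a * z))\<^sup>2 - (norm (z - a))\<^sup>2) / (norm (1 - cnj a * z))\<^sup>2"
    using nz by (simp only: norm_divide power_divide diff_divide_distrib[of "(norm (1 - cnj a * z))\<^sup>2"]) simp
  ultimately show "1 - (norm ((z - a) / (1 - cnj a * z)))\<^sup>2
      = (1 - (norm a)\<^sup>2) * (1 - (norm z)\<^sup>2) / (norm (1 - cnj a * z))\<^sup>2" by simp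
qed

lemma norm_Blaschke_factor_less_1:
  assumes "norm a < 1" "norm z < 1"
  shows "norm ((z - a) / (1 - cnj a * z)) < 1"
proof -
  have "norm (1 - cnj a * z) > 0" using Blaschke_factor_identity(2)[OF assms] assms by linarith
  moreover have "1 - (norm a)\<^sup>2 > 0" "1 - (norm z)\<^sup>2 > 0" using assms by (auto simp: abs_square_less_1)
  ultimately have "0 < 1 - (norm ((z - a) / (1 - cnj a * z)))\<^sup>2"
    unfolding Blaschke_factor_identity(1)[OF assms] by simp
  then show ?thesis using abs_square_less_1[of "norm ((z - a) / (1 - cnj a * z))"] by simp
qed

lemma finite_blaschke_holomorphic:
  assumes "\<And>l. l \<in> {1..r} \<Longrightarrow> norm (\<alpha> l) < 1"
  shows "finite_blaschke r \<alpha> holomorphic_on ball 0 1"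
proof -
  have "1 - cnj (\<alpha> l) * z \<noteq> 0" if "l \<in> {1..r}" "z \<in> ball 0 1" for l z
    using Blaschke_factor_identity(2)[OF assms[OF that(1)], of z] assms[OF that(1)] that(2) by auto
  then show ?thesis unfolding finite_blaschke_def by (intro holomorphic_intros) auto
qed

lemma norm_finite_blaschke_less_1:
  assumes "r \<ge> 1" "\<And>l. l \<in> {1..r} \<Longrightarrow> norm (\<alpha> l) < 1" "norm z < 1"
  shows "norm (finite_blaschke r \<alpha> z) < 1"
proof -
  have "norm (finite_blaschke r \<alpha> z) = (\<Prod>l=1..r. norm ((z - \<alpha> l) / (1 - cnj (\<alpha> l) * z)))"
    unfolding finite_blaschke_def by (rule prod_norm[symmetric])
  also have "\<dots> = norm ((z - \<alpha> 1) / (1 - cnj (\<alpha> 1) * z))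
      * (\<Prod>l\<in>{1..r} - {1}. norm ((z - \<alpha> l) / (1 - cnj (\<alpha> l) * z)))"
    using assms(1) by (intro prod.remove) auto
  also have "\<dots> \<le> norm ((z - \<alpha> 1) / (1 - cnj (\<alpha> 1) * z)) * 1"
    using norm_Blaschke_factor_less_1[OF assms(2) assms(3)]
    by (intro mult_left_mono prod_le_1) (auto simp: less_imp_le)
  also have "\<dots> < 1" using norm_Blaschke_factor_less_1[OF assms(2,3), of 1] assms(1) by simp
  finally show ?thesis .
qed

lemma one_minus_prod_le_sum:
  fixes x :: "'i \<Rightarrow> real"
  assumes "\<And>i. i \<in> I \<Longrightarrow> 0 \<le> x i \<and> x i \<le> 1"
  shows "1 - prod x I \<le> (\<Sum>i\<in>I. 1 - x i)"
  using assms
proof (induction I rule: infinite_finite_induct)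
  case (insert i I)
  have "1 - prod x (insert i I) = (1 - x i) + x i * (1 - prod x I)"
    using insert by (simp add: algebra_simps)
  also have "\<dots> \<le> (1 - x i) + 1 * (1 - prod x I)"
    using insert.prems prod_le_1[of I x] by (intro add_left_mono mult_right_mono) auto
  finally show ?case using insert by simp
qed auto

text \<open>
  This transfers bounds in terms of \<open>1 - \<bar>B z\<bar>\<^sup>2\<close>, the natural quantity for composition with
  \<open>B\<close>, to the distance \<open>1 - \<bar>z\<bar>\<close> from the boundary.  Each factor satisfies such an estimate by the
  identity above, and defects from 1 add up at most linearly in a product.
\<close>

lemma finite_blaschke_boundary_bound:
  assumes "\<And>l. l \<in> {1..r} \<Longrightarrow> norm (\<alpha> l) < 1"
  obtains C where "C \<ge> 0" "\<And>z. norm z < 1 \<Longrightarrow> 1 - (norm (finite_blaschke r \<alpha> z))\<^sup>2 \<le> C * (1 - norm z)"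
proof
  let ?C = "\<Sum>l=1..r. 2 / (1 - norm (\<alpha> l))\<^sup>2"
  show "?C \<ge> 0" by (intro sum_nonneg) simp
  fix z :: complex assume z: "norm z < 1"
  let ?b = "\<lambda>l. (z - \<alpha> l) / (1 - cnj (\<alpha> l) * z)"
  have "(norm (finite_blaschke r \<alpha> z))\<^sup>2 = (\<Prod>l=1..r. (norm (?b l))\<^sup>2)"
    unfolding finite_blaschke_def by (simp only: prod_norm[symmetric] prod_power_distrib)
  then have "1 - (norm (finite_blaschke r \<alpha> z))\<^sup>2 \<le> (\<Sum>l=1..r. 1 - (norm (?b l))\<^sup>2)"
    using one_minus_prod_le_sum[of "{1..r}" "\<lambda>l. (norm (?b l))\<^sup>2"] norm_Blaschke_factor_less_1[OF assms z]
    by (simp add: power_le_one less_imp_le)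
  also have "\<dots> \<le> (\<Sum>l=1..r. 2 / (1 - norm (\<alpha> l))\<^sup>2 * (1 - norm z))"
  proof (rule sum_mono)
    fix l assume l: "l \<in> {1..r}"
    have "1 - (norm (?b l))\<^sup>2 = (1 - (norm (\<alpha> l))\<^sup>2) * (1 - (norm z)\<^sup>2) / (norm (1 - cnj (\<alpha> l) * z))\<^sup>2"
      using Blaschke_factor_identity(1)[OF assms[OF l] z] .
    also have "\<dots> \<le> (1 * (2 * (1 - norm z))) / (1 - norm (\<alpha> l))\<^sup>2"
    proof (intro frac_le mult_mono power_mono)
      have "1 - (norm z)\<^sup>2 = (1 + norm z) * (1 - norm z)" by (simp add: power2_eq_square algebra_simps)
      also have "\<dots> \<le> 2 * (1 - norm z)" using z by (intro mult_right_mono) auto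
      finally show "1 - (norm z)\<^sup>2 \<le> 2 * (1 - norm z)" .
      show "1 - norm (\<alpha> l) \<le> norm (1 - cnj (\<alpha> l) * z)"
        using Blaschke_factor_identity(2)[OF assms[OF l] z] .
    qed (use z assms[OF l] in \<open>auto simp: power_le_one\<close>)
    finally show "1 - (norm (?b l))\<^sup>2 \<le> 2 / (1 - norm (\<alpha> l))\<^sup>2 * (1 - norm z)" by simp
  qed
  finally show "1 - (norm (finite_blaschke r \<alpha> z))\<^sup>2 \<le> ?C * (1 - norm z)"
    by (simp only: sum_distrib_right)
qed

section \<open>Growth of Hardy space functions on the polydisc\<close>

definition slice :: "'n::finite \<Rightarrow> complex ^ 'n \<Rightarrow> complex \<Rightarrow> complex ^ 'n" where
  "slice i w \<zeta> = (\<chi> j. if j = i then \<zeta> else w $ j)"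

lemma slice_self: "slice i w (w $ i) = w"
  by (simp add: slice_def vec_eq_iff)

lemma slice_nth [simp]: "slice i w \<zeta> $ i = \<zeta>"
  by (simp add: slice_def)

lemma slice_in_polydisc: "\<lbrakk>w \<in> polydisc; \<zeta> \<in> ball 0 1\<rbrakk> \<Longrightarrow> slice i w \<zeta> \<in> polydisc"
  by (simp add: polydisc_def slice_def)

lemma slice_holomorphic:
  fixes F :: "complex ^ 'n::finite \<Rightarrow> complex"
  assumes F: "analytic_on_polydisc F" and w: "w \<in> polydisc"
  shows "(\<lambda>\<zeta>. F (slice i w \<zeta>)) holomorphic_on ball 0 1"
  unfolding holomorphic_on_open[OF open_ball]
proof
  fix \<zeta> :: complex assume \<zeta>: "\<zeta> \<in> ball 0 1"
  obtain f' where f': "(F has_derivative f') (at (slice i w \<zeta>))" and lin: "\<And>c v. f' (c *s v) = c * f' v"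
    using F slice_in_polydisc[OF w \<zeta>] unfolding analytic_on_polydisc_def by blast
  have eq: "slice i w = (\<lambda>\<zeta>. slice i w 0 + axis i \<zeta>)"
    by (auto simp: slice_def axis_def vec_eq_iff)
  have "linear (axis i :: complex \<Rightarrow> complex ^ 'n)"
    by (auto simp: linear_iff axis_def vec_eq_iff)
  then have "bounded_linear (axis i :: complex \<Rightarrow> complex ^ 'n)" by (simp only: linear_conv_bounded_linear)
  then have "((\<lambda>\<zeta>. slice i w 0 + axis i \<zeta>) has_derivative (\<lambda>v. 0 + axis i v)) (at \<zeta>)"
    by (intro has_derivative_add has_derivative_const bounded_linear_imp_has_derivative)
  then have "((\<lambda>\<zeta>. slice i w 0 + axis i \<zeta>) has_derivative axis i) (at \<zeta>)" by simp
  then have "(slice i w has_derivative axis i) (at \<zeta>)" by (simp only: eq[symmetric])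
  from has_derivative_compose[OF this f']
  have "((\<lambda>\<zeta>. F (slice i w \<zeta>)) has_derivative (\<lambda>v. f' (axis i v))) (at \<zeta>)" .
  moreover have "(\<lambda>v. f' (axis i v)) = (*) (f' (axis i 1))"
  proof
    fix v
    have "axis i v = v *s axis i (1::complex)" by (simp add: axis_def vec_eq_iff)
    then show "f' (axis i v) = f' (axis i 1) * v" using lin by simp
  qed
  ultimately have "((\<lambda>\<zeta>. F (slice i w \<zeta>)) has_field_derivative f' (axis i 1)) (at \<zeta>)"
    unfolding has_field_derivative_def by (simp only:)
  then show "\<exists>f'. ((\<lambda>\<zeta>. F (slice i w \<zeta>)) has_field_derivative f') (at \<zeta>)" by blast
qed

lemma open_polydisc: "open (polydisc :: (complex ^ 'n::finite) set)"
proof -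
  have "polydisc = (\<Inter>i. {z :: complex ^ 'n. norm (z $ i) < 1})" by (auto simp: polydisc_def)
  also have "open \<dots>" by (intro open_INT ballI open_Collect_less continuous_intros) auto
  finally show ?thesis .
qed

text \<open>
  Continuity on the open polydisc together with the extension by zero gives measurability on the
  whole space.
\<close>

lemma hardy_space_borel_measurable:
  assumes "F \<in> hardy_space p" shows "F \<in> borel_measurable borel"
proof -
  have an: "analytic_on_polydisc F" and out: "\<And>z. z \<notin> polydisc \<Longrightarrow> F z = 0"
    using assms by (auto simp: hardy_space_def)
  have "continuous_on polydisc F"
    using an unfolding analytic_on_polydisc_def
    by (intro continuous_at_imp_continuous_on ballI) (blast dest: has_derivative_continuous)
  then have "(\<lambda>z. indicator polydisc z *\<^sub>R F z) \<in> borel_measurable borel"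
    by (intro borel_measurable_continuous_on_indicator borel_open open_polydisc)
  moreover have "(\<lambda>z. indicator polydisc z *\<^sub>R F z) = F"
    using out by (auto simp: fun_eq_iff indicator_def)
  ultimately show ?thesis by simp
qed

text \<open>
  Lebesgue measure as a product measure indexed by the coordinates, which makes Fubini available
  for one coordinate at a time.
\<close>

lemma lborel_vec_eq_distr_PiM:
  "(lborel :: (real ^ 'n::finite) measure) = distr (PiM UNIV (\<lambda>_::'n. lborel)) borel (\<lambda>f. \<chi> j. f j)"
proof (rule lborel_eqI)
  interpret product_sigma_finite "\<lambda>_::'n. lborel :: real measure" by standard
  have meas: "(\<lambda>f. \<chi> j. f j) \<in> PiM UNIV (\<lambda>_::'n. lborel :: real measure) \<rightarrow>\<^sub>M borel"
    by (subst borel_measurable_euclidean_space) (auto simp: Basis_vec_def inner_axis)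
  fix l u :: "real ^ 'n" assume le: "\<And>b. b \<in> Basis \<Longrightarrow> l \<bullet> b \<le> u \<bullet> b"
  have le': "l $ j \<le> u $ j" for j
    using le[of "axis j 1"] by (simp add: inner_axis)
  have "(\<lambda>f. \<chi> j. f j) -` box l u \<inter> space (PiM UNIV (\<lambda>_::'n. lborel :: real measure)) = (\<Pi>\<^sub>E j\<in>UNIV. {l $ j <..< u $ j})"
    by (auto simp: space_PiM mem_box_cart PiE_iff)
  then have "emeasure (distr (PiM UNIV (\<lambda>_::'n. lborel)) borel (\<lambda>f. \<chi> j. f j)) (box l u)
      = emeasure (PiM UNIV (\<lambda>_::'n. lborel)) (\<Pi>\<^sub>E j\<in>UNIV. {l $ j <..< u $ j})"
    by (simp add: emeasure_distr[OF meas])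
  also have "\<dots> = (\<Prod>j\<in>UNIV. emeasure lborel {l $ j <..< u $ j})"
    by (rule emeasure_PiM) auto
  also have "\<dots> = ennreal (\<Prod>j\<in>UNIV. u $ j - l $ j)"
    using le' by (simp add: prod_ennreal)
  also have "(\<Prod>j\<in>UNIV. u $ j - l $ j) = (\<Prod>b\<in>Basis. (u - l) \<bullet> b)"
  proof -
    have "(\<Prod>b\<in>Basis. (u - l) \<bullet> b) = (\<Prod>j\<in>UNIV. (u - l) \<bullet> axis j 1)"
      unfolding Basis_vec_def
      by (subst prod.reindex_cong[of "\<lambda>j. axis j 1" UNIV _ _ "\<lambda>j. (u - l) \<bullet> axis j 1"]) (auto simp: inj_on_def axis_eq_axis)
    then show ?thesis by (simp add: inner_axis)
  qed
  finally show "emeasure (distr (PiM UNIV (\<lambda>_::'n. lborel)) borel (\<lambda>f. \<chi> j. f j)) (box l u) = ennreal (\<Prod>b\<in>Basis. (u - l) \<bullet> b)" .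
qed simp

definition partial_torus_point :: "'n::finite set \<Rightarrow> real \<Rightarrow> complex ^ 'n \<Rightarrow> ('n \<Rightarrow> real) \<Rightarrow> complex ^ 'n" where
  "partial_torus_point I r w \<theta> = (\<chi> j. if j \<in> I then of_real r * cis (\<theta> j) else w $ j)"

lemma partial_torus_point_measurable:
  fixes F :: "complex ^ 'n::finite \<Rightarrow> complex"
  assumes F: "F \<in> borel_measurable borel"
  shows "(\<lambda>\<theta>. F (partial_torus_point I r w \<theta>)) \<in> borel_measurable (PiM I (\<lambda>_. lborel))"
proof -
  have "(\<lambda>\<theta>. partial_torus_point I r w \<theta>) \<in> PiM I (\<lambda>_. lborel :: real measure) \<rightarrow>\<^sub>M borel"
  proof (subst borel_measurable_euclidean_space, intro ballI)
    fix b :: "complex ^ 'n" assume "b \<in> Basis"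
    then obtain j c where b: "b = axis j c" by (auto simp: Basis_vec_def)
    show "(\<lambda>\<theta>. partial_torus_point I r w \<theta> \<bullet> b) \<in> borel_measurable (PiM I (\<lambda>_. lborel :: real measure))"
    proof (cases "j \<in> I")
      case True
      have "(\<lambda>\<theta>. \<theta> j) \<in> PiM I (\<lambda>_. lborel :: real measure) \<rightarrow>\<^sub>M borel"
        using measurable_component_singleton[OF True, of "\<lambda>_. lborel :: real measure"] by simp
      moreover have "(\<lambda>t. (of_real r * cis t) \<bullet> c) \<in> borel_measurable borel"
        by (intro borel_measurable_continuous_onI continuous_intros)
      ultimately show ?thesis
        using True by (simp add: b inner_axis partial_torus_point_def measurable_compose)
    qed (simp add: b inner_axis partial_torus_point_def)
  qed
  from measurable_compose[OF this F] show ?thesis .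
qed

text \<open>
  The one-variable estimate is applied in one coordinate after the other, each time under the
  integral over the coordinates already treated.
\<close>

lemma norm_powr_le_iterated_circle_integral:
  fixes F :: "complex ^ 'n::finite \<Rightarrow> complex"
  assumes F: "analytic_on_polydisc F" "F \<in> borel_measurable borel"
    and r: "0 < r" "r < 1" and w: "\<And>j. norm (w $ j) < r" and p: "p \<ge> 1"
  defines "k \<equiv> \<lambda>i t. ennreal (2 powr p / (pi * (r - norm (w $ i)))) * indicator {0..2 * pi} t"
  shows "ennreal (norm (F w) powr p)
     \<le> (\<integral>\<^sup>+\<theta>. ennreal (norm (F (partial_torus_point I r w \<theta>)) powr p) * (\<Prod>i\<in>I. k i (\<theta> i)) \<partial>PiM I (\<lambda>_. lborel))"
proof (induction I rule: finite_induct[OF finite])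
  case 1
  interpret product_sigma_finite "\<lambda>_::'n. lborel :: real measure" by standard
  have "partial_torus_point {} r w \<theta> = w" for \<theta>
    by (simp add: partial_torus_point_def vec_eq_iff)
  then show ?case by (simp add: PiM_empty nn_integral_count_space_finite)
next
  case (2 i I)
  interpret product_sigma_finite "\<lambda>_::'n. lborel :: real measure" by standard
  let ?P = "\<lambda>I \<theta>. partial_torus_point I r w \<theta>"
  let ?G = "\<lambda>I \<theta>. ennreal (norm (F (?P I \<theta>)) powr p) * (\<Prod>i\<in>I. k i (\<theta> i))"
  have G: "?G I \<in> borel_measurable (PiM I (\<lambda>_. lborel))" for I
  proof (intro borel_measurable_times_ennreal borel_measurable_prod_ennreal)
    show "(\<lambda>\<theta>. ennreal (norm (F (?P I \<theta>)) powr p)) \<in> borel_measurable (PiM I (\<lambda>_. lborel))"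
      using partial_torus_point_measurable[OF F(2), of I r w] by measurable
    fix j assume "j \<in> I"
    then have "(\<lambda>\<theta>. \<theta> j) \<in> PiM I (\<lambda>_. lborel :: real measure) \<rightarrow>\<^sub>M borel"
      using measurable_component_singleton[of j I "\<lambda>_. lborel :: real measure"] by simp
    moreover have "k j \<in> borel_measurable borel" unfolding k_def by measurable
    ultimately show "(\<lambda>\<theta>. k j (\<theta> j)) \<in> borel_measurable (PiM I (\<lambda>_. lborel))"
      by (rule measurable_compose)
  qed
  have "?G I \<theta> \<le> (\<integral>\<^sup>+t. ?G (insert i I) (\<theta>(i := t)) \<partial>lborel)" for \<theta>
  proof -
    let ?u = "?P I \<theta>"
    have u: "?u \<in> polydisc" "?u $ i = w $ i"
      using 2(2) r less_trans[OF w r(2)] by (auto simp: polydisc_def partial_torus_point_def norm_mult)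
    have pt: "?P (insert i I) (\<theta>(i := t)) = slice i ?u (of_real r * cis t)" for t
      using 2(2) by (auto simp: slice_def partial_torus_point_def vec_eq_iff)
    have slice: "(\<lambda>\<zeta>. F (slice i ?u \<zeta>)) holomorphic_on ball 0 1"
      by (rule slice_holomorphic[OF F(1) u(1)])
    have pr: "(\<Prod>j\<in>I. k j ((\<theta>(i := t)) j)) = (\<Prod>j\<in>I. k j (\<theta> j))" for t
      using 2(2) by (intro prod.cong) auto
    have "continuous_on UNIV (\<lambda>t. F (slice i ?u (of_real r * cis t)))"
      using r by (intro continuous_on_compose2[OF holomorphic_on_imp_continuous_on[OF slice]])
        (auto intro!: continuous_intros simp: dist_norm norm_mult)
    then have meas: "(\<lambda>t. ennreal (norm (F (slice i ?u (of_real r * cis t))) powr p) * indicator {0..2 * pi} t) \<in> borel_measurable lborel"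
      by (auto dest!: borel_measurable_continuous_onI)
    have "ennreal (norm (F ?u) powr p) \<le> ennreal (2 powr p / (pi * (r - norm (w $ i))))
       * (\<integral>\<^sup>+t. ennreal (norm (F (slice i ?u (of_real r * cis t))) powr p) * indicator {0..2 * pi} t \<partial>lborel)"
      using norm_powr_le_circle_nn_integral[OF slice r w p, of i] slice_self[of i ?u] u by simp
    then have "?G I \<theta> \<le> (ennreal (2 powr p / (pi * (r - norm (w $ i))))
       * (\<integral>\<^sup>+t. ennreal (norm (F (slice i ?u (of_real r * cis t))) powr p) * indicator {0..2 * pi} t \<partial>lborel))
       * (\<Prod>j\<in>I. k j (\<theta> j))"
      by (rule mult_right_mono) simp
    also have "\<dots> = (\<integral>\<^sup>+t. (ennreal (2 powr p / (pi * (r - norm (w $ i)))) * (\<Prod>j\<in>I. k j (\<theta> j)))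
        * (ennreal (norm (F (slice i ?u (of_real r * cis t))) powr p) * indicator {0..2 * pi} t) \<partial>lborel)"
      by (subst nn_integral_cmult[OF meas]) (simp add: mult_ac)
    also have "\<dots> = (\<integral>\<^sup>+t. ?G (insert i I) (\<theta>(i := t)) \<partial>lborel)"
    proof (intro nn_integral_cong)
      fix t
      have "(\<Prod>j\<in>insert i I. k j ((\<theta>(i := t)) j)) = k i t * (\<Prod>j\<in>I. k j (\<theta> j))"
        by (simp only: prod.insert[OF 2(1,2)] fun_upd_same pr)
      moreover have "k i t = ennreal (2 powr p / (pi * (r - norm (w $ i)))) * indicator {0..2 * pi} t"
        by (simp only: k_def)
      ultimately show "(ennreal (2 powr p / (pi * (r - norm (w $ i)))) * (\<Prod>j\<in>I. k j (\<theta> j)))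
          * (ennreal (norm (F (slice i ?u (of_real r * cis t))) powr p) * indicator {0..2 * pi} t)
        = ?G (insert i I) (\<theta>(i := t))"
        by (simp only: pt mult_ac)
    qed
    finally show ?thesis .
  qed
  then have "(\<integral>\<^sup>+\<theta>. ?G I \<theta> \<partial>PiM I (\<lambda>_. lborel))
      \<le> (\<integral>\<^sup>+\<theta>. (\<integral>\<^sup>+t. ?G (insert i I) (\<theta>(i := t)) \<partial>lborel) \<partial>PiM I (\<lambda>_. lborel))"
    by (intro nn_integral_mono)
  also have "\<dots> = (\<integral>\<^sup>+\<theta>. ?G (insert i I) \<theta> \<partial>PiM (insert i I) (\<lambda>_. lborel))"
    by (rule product_nn_integral_insert[symmetric, OF 2(1,2) G])
  finally show ?case using 2(3) by (rule order_trans[rotated])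
qed

lemma norm_powr_le_torus_mean:
  fixes F :: "complex ^ 'n::finite \<Rightarrow> complex"
  assumes F: "analytic_on_polydisc F" "F \<in> borel_measurable borel"
    and r: "0 < r" "r < 1" and w: "\<And>j. norm (w $ j) < r" and p: "p \<ge> 1"
  shows "ennreal (norm (F w) powr p)
     \<le> ennreal (\<Prod>i\<in>UNIV. 2 powr p / (pi * (r - norm (w $ i)))) * (ennreal ((2 * pi) ^ CARD('n)) * torus_mean p F r)"
proof -
  let ?c = "\<lambda>i. 2 powr p / (pi * (r - norm (w $ i)))"
  let ?f = "\<lambda>\<theta>::real ^ 'n. ennreal (norm (F (\<chi> j. of_real r * cis (\<theta> $ j))) powr p) * indicator (cbox 0 (\<chi> j. 2 * pi)) \<theta>"
  have chi: "(\<lambda>f. \<chi> j. f j) \<in> PiM UNIV (\<lambda>_::'n. lborel :: real measure) \<rightarrow>\<^sub>M borel"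
    by (subst borel_measurable_euclidean_space) (auto simp: Basis_vec_def inner_axis)
  have c0: "?c i \<ge> 0" for i using w[of i] by simp
  have ind: "(\<Prod>i\<in>UNIV. indicator {0..2 * pi} (\<theta> i) :: ennreal) = indicator (cbox 0 (\<chi> j. 2 * pi)) (\<chi> j. \<theta> j)" for \<theta> :: "'n \<Rightarrow> real"
  proof (cases "\<forall>i. \<theta> i \<in> {0..2 * pi}")
    case False
    then obtain i where "\<theta> i \<notin> {0..2 * pi}" by blast
    then have "(\<Prod>i\<in>UNIV. indicator {0..2 * pi} (\<theta> i) :: ennreal) = 0"
      by (intro prod_zero finite bexI[of _ i]) auto
    then show ?thesis using False by (auto simp: indicator_def mem_box_cart)
  qed (simp add: mem_box_cart)
  have fm: "?f \<in> borel_measurable borel"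
  proof -
    have "(\<lambda>\<theta>::real ^ 'n. \<chi> j. of_real r * cis (\<theta> $ j)) \<in> borel \<rightarrow>\<^sub>M (borel :: (complex ^ 'n) measure)"
      by (intro borel_measurable_continuous_onI continuous_intros)
    from measurable_compose[OF this F(2)] show ?thesis by measurable
  qed
  have "ennreal (norm (F w) powr p) \<le> (\<integral>\<^sup>+\<theta>. ennreal (norm (F (\<chi> j. of_real r * cis (\<theta> j))) powr p)
      * (\<Prod>i\<in>UNIV. ennreal (?c i) * indicator {0..2 * pi} (\<theta> i)) \<partial>PiM UNIV (\<lambda>_::'n. lborel))"
    using norm_powr_le_iterated_circle_integral[OF assms, where I = UNIV] by (simp add: partial_torus_point_def)
  also have "\<dots> = (\<integral>\<^sup>+\<theta>. ennreal (\<Prod>i\<in>UNIV. ?c i) * ?f (\<chi> j. \<theta> j) \<partial>PiM UNIV (\<lambda>_::'n. lborel))"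
  proof (intro nn_integral_cong)
    fix \<theta> :: "'n \<Rightarrow> real"
    have "(\<Prod>i\<in>UNIV. ennreal (?c i)) = ennreal (\<Prod>i\<in>UNIV. ?c i)"
      using c0 by (intro prod_ennreal)
    then have "(\<Prod>i\<in>UNIV. ennreal (?c i) * indicator {0..2 * pi} (\<theta> i))
        = ennreal (\<Prod>i\<in>UNIV. ?c i) * indicator (cbox 0 (\<chi> j. 2 * pi)) (\<chi> j. \<theta> j)"
      by (simp only: prod.distrib ind)
    then show "ennreal (norm (F (\<chi> j. of_real r * cis (\<theta> j))) powr p)
        * (\<Prod>i\<in>UNIV. ennreal (?c i) * indicator {0..2 * pi} (\<theta> i)) = ennreal (\<Prod>i\<in>UNIV. ?c i) * ?f (\<chi> j. \<theta> j)"
      by (simp only: vec_lambda_beta mult.left_commute)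
  qed
  also have "\<dots> = (\<integral>\<^sup>+\<theta>. ennreal (\<Prod>i\<in>UNIV. ?c i) * ?f \<theta> \<partial>lborel)"
    unfolding lborel_vec_eq_distr_PiM
    using fm by (subst nn_integral_distr[OF chi]) auto
  also have "\<dots> = ennreal (\<Prod>i\<in>UNIV. ?c i) * (\<integral>\<^sup>+\<theta>. ?f \<theta> \<partial>lborel)"
    using fm by (intro nn_integral_cmult) auto
  also have "(\<integral>\<^sup>+\<theta>. ?f \<theta> \<partial>lborel) = ennreal ((2 * pi) ^ CARD('n)) * torus_mean p F r"
  proof -
    have "ennreal c * (X / ennreal c) = X" if "c > 0" for c X
      using that by (simp add: ennreal_times_divide mult.commute[of "ennreal c"] ennreal_mult_divide_eq)
    then show ?thesis unfolding torus_mean_def by simp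
  qed
  finally show ?thesis .
qed

text \<open>
  The torus estimate, on a torus whose radius lies between the point and the boundary.
\<close>

proposition hardy_space_growth:
  fixes F :: "complex ^ 'n::finite \<Rightarrow> complex"
  assumes F: "F \<in> hardy_space p" and p: "1 \<le> p" "p \<noteq> \<infinity>"
  obtains K where "\<And>w. w \<in> polydisc \<Longrightarrow> norm (F w) powr (enn2real p) \<le> K * (\<Prod>i\<in>UNIV. 1 / (1 - norm (w $ i)))"
proof -
  define q where "q = enn2real p"
  have q: "q \<ge> 1" unfolding q_def using p enn2real_mono[of 1 p] by (simp add: less_top)
  have an: "analytic_on_polydisc F" and bounded: "(SUP r\<in>{0..<1}. torus_mean q F r) < \<infinity>"
    using F p by (auto simp: hardy_space_def q_def)
  define S where "S = enn2real (SUP r\<in>{0..<1}. torus_mean q F r)"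
  have S: "torus_mean q F r \<le> ennreal S" if "r \<in> {0..<1}" for r
    using SUP_upper[OF that, of "torus_mean q F"] bounded unfolding S_def by (simp add: less_top)
  have S0: "S \<ge> 0" by (simp add: S_def)
  define K where "K = (2 * 2 powr q / pi) ^ CARD('n) * ((2 * pi) ^ CARD('n) * S)"
  have "norm (F w) powr q \<le> K * (\<Prod>i\<in>UNIV. 1 / (1 - norm (w $ i)))" if w: "w \<in> polydisc" for w
  proof -
    have w1: "norm (w $ j) < 1" for j using w by (simp add: polydisc_def)
    \<comment> \<open>at least halfway from \<open>\<bar>w $ j\<bar>\<close> to 1 for every \<open>j\<close>, so \<open>r - \<bar>w $ j\<bar> \<ge> (1 - \<bar>w $ j\<bar>) / 2\<close>\<close>
    define r where "r = Max (range (\<lambda>j. (1 + norm (w $ j)) / 2))"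
    have r_ge: "(1 + norm (w $ j)) / 2 \<le> r" for j unfolding r_def by (rule Max_ge) auto
    have "r < 1" unfolding r_def using w1 by (subst Max_less_iff) auto
    moreover have "0 < (1 + norm (w $ j)) / 2" for j by (simp add: add_pos_nonneg)
    then have "r > 0" using r_ge less_le_trans by blast
    ultimately have r: "0 < r" "r < 1" by auto
    have wr: "norm (w $ j) < r" for j using r_ge[of j] w1[of j] by (simp add: field_simps)
    have "ennreal (norm (F w) powr q) \<le> ennreal (\<Prod>i\<in>UNIV. 2 powr q / (pi * (r - norm (w $ i))))
        * (ennreal ((2 * pi) ^ CARD('n)) * ennreal S)"
      using norm_powr_le_torus_mean[OF an hardy_space_borel_measurable[OF F] r wr q] S[of r] r
      by (elim order_trans) (auto intro!: mult_left_mono)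
    also have "\<dots> = ennreal ((\<Prod>i\<in>UNIV. 2 powr q / (pi * (r - norm (w $ i)))) * ((2 * pi) ^ CARD('n) * S))"
      using S0 wr by (simp add: ennreal_mult prod_nonneg less_imp_le)
    finally have "norm (F w) powr q \<le> (\<Prod>i\<in>UNIV. 2 powr q / (pi * (r - norm (w $ i)))) * ((2 * pi) ^ CARD('n) * S)"
      using S0 wr by (subst (asm) ennreal_le_iff) (auto intro!: mult_nonneg_nonneg prod_nonneg simp: less_imp_le)
    also have "\<dots> \<le> (\<Prod>i\<in>UNIV. (2 * 2 powr q / pi) * (1 / (1 - norm (w $ i)))) * ((2 * pi) ^ CARD('n) * S)"
    proof (intro mult_right_mono prod_mono conjI)
      fix i
      show "0 \<le> 2 powr q / (pi * (r - norm (w $ i)))" using wr[of i] by simp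
      have "2 powr q / (pi * (r - norm (w $ i))) \<le> 2 powr q / (pi * ((1 - norm (w $ i)) / 2))"
        using r_ge[of i] w1[of i] wr[of i] by (intro divide_left_mono mult_left_mono mult_pos_pos) (auto simp: field_simps)
      then show "2 powr q / (pi * (r - norm (w $ i))) \<le> (2 * 2 powr q / pi) * (1 / (1 - norm (w $ i)))"
        by (simp add: mult.commute)
    qed (use S0 in simp)
    also have "\<dots> = K * (\<Prod>i\<in>UNIV. 1 / (1 - norm (w $ i)))"
      unfolding K_def prod.distrib by simp
    finally show ?thesis .
  qed
  then show thesis using that unfolding q_def by blast
qed

text \<open>
  With all other coordinates fixed, only one factor of the growth estimate varies.  The exponent is
  \<open>q = 1 / p\<close>, read as 0 for \<open>p = \<infinity>\<close>; the hypothesis \<open>p > 2\<close> is what makes it smaller than the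
  exponent \<open>1 / 2\<close> of the evaluations on \<open>H\<^sup>2\<close>.
\<close>

lemma hardy_space_slice_growth:
  assumes p: "2 < p"
  obtains q where "0 \<le> q" "q < 1/2"
    and "\<And>(F :: complex ^ 'n::finite \<Rightarrow> complex) w i. \<lbrakk>F \<in> hardy_space p; w \<in> polydisc\<rbrakk>
      \<Longrightarrow> \<exists>C. \<forall>\<zeta>\<in>ball 0 1. norm (F (slice i w \<zeta>)) * (1 - norm \<zeta>) powr q \<le> C"
proof (cases "p = \<infinity>")
  case True
  have "\<exists>C. \<forall>\<zeta>\<in>ball 0 1. norm (F (slice i w \<zeta>)) * (1 - norm \<zeta>) powr 0 \<le> C"
    if F: "F \<in> hardy_space p" and w: "w \<in> polydisc" for F :: "complex ^ 'n \<Rightarrow> complex" and w i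
  proof -
    have "bounded (F ` polydisc)" using F True by (simp add: hardy_space_def)
    then obtain C where "\<forall>x\<in>F ` polydisc. norm x \<le> C" unfolding bounded_iff by blast
    then show ?thesis using slice_in_polydisc[OF w] by (intro exI[of _ C]) auto
  qed
  then show thesis by (intro that[of 0]) auto
next
  case False
  define P where "P = enn2real p"
  have P: "P > 2" "p = ennreal P"
  proof -
    show "p = ennreal P" using False by (simp add: P_def less_top)
    then show "P > 2" using p by (metis ennreal_less_iff ennreal_numeral zero_le_numeral)
  qed
  have "\<exists>C. \<forall>\<zeta>\<in>ball 0 1. norm (F (slice i w \<zeta>)) * (1 - norm \<zeta>) powr (1 / P) \<le> C"
    if F: "F \<in> hardy_space p" and w: "w \<in> polydisc" for F :: "complex ^ 'n \<Rightarrow> complex" and w i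
  proof -
    have "1 \<le> p" using p by (metis less_imp_le one_le_numeral order_trans)
    then obtain K where K: "\<And>w. w \<in> polydisc \<Longrightarrow> norm (F w) powr P \<le> K * (\<Prod>i\<in>UNIV. 1 / (1 - norm (w $ i)))"
      using hardy_space_growth[OF F _ False] unfolding P_def by metis
    define L where "L = K * (\<Prod>j\<in>UNIV - {i}. 1 / (1 - norm (w $ j)))"
    have "norm (F (slice i w \<zeta>)) * (1 - norm \<zeta>) powr (1 / P) \<le> L powr (1 / P)" if \<zeta>: "\<zeta> \<in> ball 0 1" for \<zeta>
    proof -
      let ?x = "norm (F (slice i w \<zeta>))"
      have pos: "1 - norm \<zeta> > 0" using \<zeta> by simp
      have "(\<Prod>j\<in>UNIV. 1 / (1 - norm (slice i w \<zeta> $ j)))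
          = 1 / (1 - norm \<zeta>) * (\<Prod>j\<in>UNIV - {i}. 1 / (1 - norm (slice i w \<zeta> $ j)))"
        by (subst prod.remove[of _ i]) auto
      also have "(\<Prod>j\<in>UNIV - {i}. 1 / (1 - norm (slice i w \<zeta> $ j))) = (\<Prod>j\<in>UNIV - {i}. 1 / (1 - norm (w $ j)))"
        by (intro prod.cong) (auto simp: slice_def)
      finally have "?x powr P \<le> L / (1 - norm \<zeta>)"
        using K[OF slice_in_polydisc[OF w \<zeta>, of i]] by (simp add: L_def)
      then have "?x powr P * (1 - norm \<zeta>) \<le> L" using pos by (simp add: pos_le_divide_eq)
      then have "(?x powr P * (1 - norm \<zeta>)) powr (1 / P) \<le> L powr (1 / P)"
        using pos P by (intro powr_mono2) auto
      then show ?thesis using P pos by (simp add: powr_mult powr_powr)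
    qed
    then show ?thesis by blast
  qed
  then show thesis using P by (intro that[of "1 / P"]) auto
qed

section \<open>Square-summable series of powers of a multiplier\<close>

lemma coord_mult_power: "(coord_mult B i ^^ m) f z = B i (z $ i) ^ m * f z"
  by (induction m) (simp_all add: coord_mult_def)

lemma square_summable_bounded:
  fixes c :: "nat \<Rightarrow> complex"
  assumes "summable (\<lambda>k. (norm (c k))\<^sup>2)"
  shows "\<exists>K. \<forall>k. norm (c k) \<le> K"
proof (intro exI allI)
  fix k
  have "(norm (c k))\<^sup>2 \<le> (\<Sum>k. (norm (c k))\<^sup>2)"
    using sum_le_suminf[OF assms, of "{k}"] by simp
  then show "norm (c k) \<le> sqrt (\<Sum>k. (norm (c k))\<^sup>2)" by (rule real_le_rsqrt)
qed

lemma square_summable_power_series_holomorphic: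
  fixes c :: "nat \<Rightarrow> complex"
  assumes "summable (\<lambda>k. (norm (c k))\<^sup>2)"
  shows "(\<lambda>x. \<Sum>k. c (k + m) * x ^ k) holomorphic_on ball 0 1"
proof -
  obtain K where K: "\<And>k. norm (c k) \<le> K" using square_summable_bounded[OF assms] by blast
  show ?thesis
  proof (rule power_series_holomorphic)
    fix x :: complex assume "x \<in> ball 0 1"
    then have "norm x < 1" by simp
    from summable_power_bounded_coeffs(1)[OF this K, of "\<lambda>k. k + m"]
    show "(\<lambda>k. c (k + m) * (x - 0) ^ k) sums (\<Sum>k. c (k + m) * x ^ k)"
      by (simp add: summable_sums)
  qed
qed

text \<open>
  The values \<open>G m \<zeta>\<close> need not tend to 0 as \<open>m\<close> grows.  But the difference of the two sides is
  divisible by every power of \<open>b\<close>, so it vanishes to infinite order at a zero of \<open>b\<close>.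
\<close>

lemma series_tails_determine_function:
  fixes c :: "nat \<Rightarrow> complex"
  assumes b: "b holomorphic_on ball 0 1" "\<And>\<zeta>. \<zeta> \<in> ball 0 1 \<Longrightarrow> norm (b \<zeta>) < 1" "\<alpha> \<in> ball 0 1" "b \<alpha> = 0"
    and c: "summable (\<lambda>k. (norm (c k))\<^sup>2)"
    and E: "E holomorphic_on ball 0 1" and G: "\<And>m. G m holomorphic_on ball 0 1"
    and rec: "\<And>m \<zeta>. \<zeta> \<in> ball 0 1 \<Longrightarrow> G m \<zeta> = c m * E \<zeta> + b \<zeta> * G (Suc m) \<zeta>"
    and \<zeta>: "\<zeta> \<in> ball 0 1"
  shows "G 0 \<zeta> = E \<zeta> * (\<Sum>k. c k * b \<zeta> ^ k)"
proof -
  let ?g = "\<lambda>m \<zeta>. \<Sum>k. c (k + m) * b \<zeta> ^ k"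
  let ?q = "\<lambda>m \<zeta>. G m \<zeta> - E \<zeta> * ?g m \<zeta>"
  have hol: "?q m holomorphic_on ball 0 1" for m
  proof -
    have "?g m holomorphic_on ball 0 1"
    proof -
      have "b ` ball 0 1 \<subseteq> ball 0 1" using b(2) by auto
      from holomorphic_on_compose_gen[OF b(1) square_summable_power_series_holomorphic[OF c] this]
      show ?thesis by (simp add: o_def)
    qed
    then show ?thesis by (intro holomorphic_intros E G)
  qed
  obtain K where K: "\<And>k. norm (c k) \<le> K" using square_summable_bounded[OF c] by blast
  have step: "?q m \<zeta> = b \<zeta> * ?q (Suc m) \<zeta>" if \<zeta>: "\<zeta> \<in> ball 0 1" for m \<zeta>
  proof -
    have summ: "summable (\<lambda>k. c (k + m) * b \<zeta> ^ k)" for m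
      using summable_power_bounded_coeffs(1)[OF b(2)[OF \<zeta>] K, of "\<lambda>k. k + m"] .
    have "?g m \<zeta> = c m + (\<Sum>k. c (Suc k + m) * b \<zeta> ^ Suc k)"
      using suminf_split_head[OF summ, of m] by simp
    also have "(\<Sum>k. c (Suc k + m) * b \<zeta> ^ Suc k) = (\<Sum>k. b \<zeta> * (c (k + Suc m) * b \<zeta> ^ k))"
      by (simp add: mult_ac)
    also have "\<dots> = b \<zeta> * ?g (Suc m) \<zeta>"
      by (rule suminf_mult[OF summ])
    finally have "?g m \<zeta> = c m + b \<zeta> * ?g (Suc m) \<zeta>" .
    then show ?thesis unfolding rec[OF \<zeta>, of m] by (simp add: algebra_simps)
  qed
  have "?q 0 \<zeta> = b \<zeta> ^ m * ?q m \<zeta>" if "\<zeta> \<in> ball 0 1" for m \<zeta>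
  proof (induction m)
    case (Suc m)
    show ?case unfolding Suc.IH step[OF that, of m] by (simp only: power_Suc mult_ac)
  qed simp
  then have "\<exists>q. q holomorphic_on ball 0 1 \<and> (\<forall>\<zeta>\<in>ball 0 1. ?q 0 \<zeta> = b \<zeta> ^ m * q \<zeta>)" for m
    using hol by blast
  from holomorphic_infinite_order_zero[OF hol b(1,3,4) this \<zeta>] show ?thesis by simp
qed

section \<open>Triviality of the Hilbert space\<close>

theorem theorem4p8:
  fixes r :: "'n::finite \<Rightarrow> nat"
    and \<alpha> :: "'n \<Rightarrow> nat \<Rightarrow> complex"
    and B :: "'n \<Rightarrow> complex \<Rightarrow> complex"
    and p :: ennreal
    and M :: "(complex ^ 'n \<Rightarrow> complex) set"
    and ip :: "(complex ^ 'n \<Rightarrow> complex) \<Rightarrow> (complex ^ 'n \<Rightarrow> complex) \<Rightarrow> complex"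
  assumes "\<And>i. r i \<ge> 1"
    and "\<And>i l. l \<in> {1..r i} \<Longrightarrow> norm (\<alpha> i l) < 1"
    and "\<And>i. B i = finite_blaschke (r i) (\<alpha> i)"
    and "2 < p"
    and "complex_hilbert_space fun_scale M ip"
    and "M \<subseteq> hardy_space p"
    and "\<And>j. coord_mult B j ` M \<subseteq> M"
    and "\<And>j. near_isometry_on fun_scale M ip (coord_mult B j)"
    and "doubly_commuting_on M ip (coord_mult B)"
  shows "M = {0}"
proof (rule ccontr)
  assume "M \<noteq> {0}"
  interpret complex_hilbert_space fun_scale M ip by fact
  \<comment> \<open>an arbitrary coordinate\<close>
  define i :: 'n where "i = undefined"
  let ?T = "coord_mult B i" and ?b = "B i"
  note T = assms(8)[of i]
  have analytic: "analytic_on_polydisc f" and out: "\<And>z. z \<notin> polydisc \<Longrightarrow> f z = 0" if "f \<in> M" for f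
    using that assms(6) by (auto simp: hardy_space_def)
  have slice_hol: "(\<lambda>\<zeta>. f (slice i w \<zeta>)) holomorphic_on ball 0 1" if "f \<in> M" "w \<in> polydisc" for f w
    using slice_holomorphic[OF analytic[OF that(1)] that(2)] .
  have nonzero_point: "\<exists>w\<in>polydisc. f w \<noteq> 0" if "f \<in> M" "f \<noteq> 0" for f
    using out[OF that(1)] that(2) by (auto simp: fun_eq_iff)
  have b_hol: "?b holomorphic_on ball 0 1"
    unfolding assms(3) using assms(2) by (intro finite_blaschke_holomorphic)
  have b_less: "norm (?b \<zeta>) < 1" if "\<zeta> \<in> ball 0 1" for \<zeta>
    unfolding assms(3) using assms(1,2) that by (intro norm_finite_blaschke_less_1) auto
  have \<alpha>: "\<alpha> i 1 \<in> ball 0 1" using assms(1)[of i] assms(2)[of 1 i] by simp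
  have b_zero: "?b (\<alpha> i 1) = 0"
    unfolding assms(3) finite_blaschke_def using assms(1)[of i]
    by (intro prod_zero finite_atLeastAtMost bexI[of _ 1]) auto

  obtain f where f: "f \<in> M" "f \<noteq> 0" using \<open>M \<noteq> {0}\<close> zero_carrier by blast
  have "?T ` M \<noteq> M"
  proof
    assume surj: "?T ` M = M"
    have power_surj: "\<exists>g\<in>M. f = (?T ^^ m) g" for m
    proof (induction m)
      case (Suc m)
      then obtain g where g: "g \<in> M" "f = (?T ^^ m) g" by blast
      then obtain h where "h \<in> M" "g = ?T h" using surj by blast
      then show ?case using g by (intro bexI[of _ h]) (simp_all add: funpow_swap1)
    qed (use f in auto)
    obtain w where w: "w \<in> polydisc" "f w \<noteq> 0" using nonzero_point[OF f] by blast
    have wi: "w $ i \<in> ball 0 1" using w by (simp add: polydisc_def)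
    have "\<exists>q. q holomorphic_on ball 0 1 \<and> (\<forall>\<zeta>\<in>ball 0 1. f (slice i w \<zeta>) = ?b \<zeta> ^ m * q \<zeta>)" for m
    proof -
      obtain g where g: "g \<in> M" "f = (?T ^^ m) g" using power_surj by blast
      then show ?thesis using slice_hol[OF g(1) w(1)]
        by (intro exI[of _ "\<lambda>\<zeta>. g (slice i w \<zeta>)"]) (simp add: coord_mult_power)
    qed
    from holomorphic_infinite_order_zero[OF slice_hol[OF f(1) w(1)] b_hol \<alpha> b_zero this wi]
    show False using w by (simp add: slice_self)
  qed
  then obtain e where e: "e \<in> M" "e \<noteq> 0" and wandering: "\<And>x. x \<in> M \<Longrightarrow> ip (?T x) e = 0"
    using near_isometry_wandering_vector_exists[OF T] by blast
  obtain w where w: "w \<in> polydisc" "e w \<noteq> 0" using nonzero_point[OF e] by blast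
  define E where "E \<zeta> = e (slice i w \<zeta>)" for \<zeta>
  have E_hol: "E holomorphic_on ball 0 1" unfolding E_def using slice_hol[OF e(1) w(1)] .
  obtain q where q: "0 \<le> q" "q < 1/2" and growth: "\<And>F :: complex ^ 'n \<Rightarrow> complex. F \<in> hardy_space p
      \<Longrightarrow> \<exists>C. \<forall>\<zeta>\<in>ball 0 1. norm (F (slice i w \<zeta>)) * (1 - norm \<zeta>) powr q \<le> C"
    using hardy_space_slice_growth[OF assms(4)] w(1) by metis
  \<comment> \<open>The product of \<open>e\<close> with any \<open>H\<^sup>2\<close> function of \<open>B i (z $ i)\<close> lies in \<open>M\<close>, so it obeys the \<open>H\<^sup>p\<close> growth bound.\<close>
  have bounded: "\<exists>K. \<forall>\<zeta>\<in>ball 0 1. (norm (E \<zeta>) * (1 - norm \<zeta>) powr q) * norm (\<Sum>k. c k * ?b \<zeta> ^ k) \<le> K"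
    if c: "summable (\<lambda>k. (norm (c k))\<^sup>2)" for c
  proof -
    obtain G where GM: "\<And>m. G m \<in> M" and G: "\<And>m::nat. G m = fun_scale (c m) e + ?T (G (Suc m))"
      using near_isometry_wandering_series_tails[OF T e(1) wandering c] by blast
    have "G 0 (slice i w \<zeta>) = E \<zeta> * (\<Sum>k. c k * ?b \<zeta> ^ k)" if "\<zeta> \<in> ball 0 1" for \<zeta>
    proof (rule series_tails_determine_function[OF b_hol b_less \<alpha> b_zero c E_hol _ _ that])
      show "(\<lambda>\<zeta>. G m (slice i w \<zeta>)) holomorphic_on ball 0 1" for m
        using slice_hol[OF GM w(1)] .
      show "G m (slice i w \<zeta>) = c m * E \<zeta> + ?b \<zeta> * G (Suc m) (slice i w \<zeta>)" for m \<zeta>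
        by (subst G) (simp add: fun_scale_def coord_mult_def E_def)
    qed
    moreover have "G 0 \<in> hardy_space p" using GM assms(6) by blast
    from growth[OF this] obtain C where "\<forall>\<zeta>\<in>ball 0 1. norm (G 0 (slice i w \<zeta>)) * (1 - norm \<zeta>) powr q \<le> C" by blast
    ultimately show ?thesis by (intro exI[of _ C]) (simp add: norm_mult mult_ac)
  qed
  \<comment> \<open>Taking the supremum over the unit ball of \<open>H\<^sup>2\<close> gains the exponent 1/2 for \<open>e\<close> itself.\<close>
  obtain C where C: "\<And>\<zeta>. \<zeta> \<in> ball 0 1 \<Longrightarrow> norm (E \<zeta>) * (1 - norm \<zeta>) powr q \<le> C * sqrt (1 - (norm (?b \<zeta>))\<^sup>2)"
    using evaluations_uniformly_bounded[where Z = "ball 0 1" and W = ?b, OF b_less bounded] by blast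
  obtain D where D: "D \<ge> 0" "\<And>\<zeta>. norm \<zeta> < 1 \<Longrightarrow> 1 - (norm (?b \<zeta>))\<^sup>2 \<le> D * (1 - norm \<zeta>)"
    using finite_blaschke_boundary_bound[of "r i" "\<alpha> i", OF assms(2)] unfolding assms(3) by blast
  have E_small: "norm (E \<zeta>) \<le> (\<bar>C\<bar> * sqrt D) * (1 - norm \<zeta>) powr (1/2 - q)" if \<zeta>: "\<zeta> \<in> ball 0 1" for \<zeta>
  proof -
    have pos: "1 - norm \<zeta> > 0" using \<zeta> by simp
    have "norm (E \<zeta>) * (1 - norm \<zeta>) powr q \<le> \<bar>C\<bar> * sqrt (1 - (norm (?b \<zeta>))\<^sup>2)"
      using C[OF \<zeta>] b_less[OF \<zeta>]
      by (elim order_trans) (auto intro!: mult_right_mono simp: power_le_one)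
    also have "\<dots> \<le> \<bar>C\<bar> * sqrt (D * (1 - norm \<zeta>))"
      using D(2)[of \<zeta>] \<zeta> by (intro mult_left_mono real_sqrt_le_mono) auto
    also have "\<dots> = (\<bar>C\<bar> * sqrt D) * (1 - norm \<zeta>) powr (1/2)"
      using pos by (simp add: real_sqrt_mult powr_half_sqrt)
    also have "\<dots> = (\<bar>C\<bar> * sqrt D) * (1 - norm \<zeta>) powr (1/2 - q) * (1 - norm \<zeta>) powr q"
      by (simp add: powr_add[symmetric])
    finally show ?thesis using pos by simp
  qed
  have "E (w $ i) = 0"
  proof (rule holomorphic_zero_if_vanishing_at_boundary[OF E_hol _ E_small])
    show "0 < 1/2 - q" using q by simp
    show "w $ i \<in> ball 0 1" using w(1) by (simp add: polydisc_def)
  qed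
  then show False using w(2) by (simp add: E_def slice_self)
qed

end
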